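(* Let $G$ be a plane graph, let $n$ be even, and let $a_1, a_2, \ldots, a_n$ be distinct vertices appearing in this cyclic order on a face of $G$; put $A=\{a_1,\ldots,a_n\}$. Let $A=A_K\cup A_H$ be a partition of $A$ into two disjoint subsets, and let $H=G-A_K$ and $K=G-A_H$. For $1\le i<j\le n$ define the subgraph $H_{ij}$ of $G$ by: (i) if $a_i,a_j\in A_K$, $H_{ij}$ is the subgraph of $G$ induced by $V(H)\cup\{a_i,a_j\}$; (ii) if $a_i\in A_K$, $a_j\in A_H$, $H_{ij}$ is induced by $(V(H)\setminus\{a_j\})\cup\{a_i\}$; (iii) if $a_i\in A_H$, $a_j\in A_K$, $H_{ij}$ is induced by $(V(H)\setminus\{a_i\})\cup\{a_j\}$; (iv) if $a_i,a_j\in A_H$, $H_{ij}=H-a_i-a_j$. If $H$ has exactly one perfect matching, then \[ M(K) = \mathrm{Pf}\big(M(H_{ij})\big)_{1\le i<j\le n}. \]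
   Context: $M(\Gamma)$ denotes the number of perfect matchings of a graph $\Gamma$. For a set $S$ of vertices, $G-S$ is the subgraph of $G$ induced by the vertices not in $S$. For even $n$ and numbers $m_{ij}$ ($1\le i<j\le n$), the Pfaffian is $\mathrm{Pf}(m_{ij}) = \sum_{F} (-1)^{\chi(F)} \prod_{\{i,j\}\in F,\, i<j} m_{ij}$, where $F$ ranges over all partitions of $\{1,\ldots,n\}$ into pairs and $\chi(F)$ is the number of pairs of pairs $\{a,b\},\{c,d\}\in F$ with $a<c<b<d$ (this is the Pfaffian of the skew-symmetric matrix with above-diagonal entries $m_{ij}$). *)

theory Defs
  imports "HOL-Analysis.Analysis" "HOL-Library.Disjoint_Sets"
begin

section \<open>Plane graphs\<close>

text \<open>The plane is the type of complex numbers. An edge is an arc, identified with its set of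
  points, so that incidence of a vertex and an edge is membership; distinct edges may have the
  same two end vertices.\<close>

record drawn_graph =
  verts :: "complex set"
  edges :: "complex set set"

text \<open>The condition on \<open>e \<inter> verts G\<close> says that both ends of the edge are vertices and that its
  interior contains no vertex; the last condition then says that the interior of an edge contains
  no point of another edge.\<close>

definition plane_graph :: "drawn_graph \<Rightarrow> bool" where
  "plane_graph G \<longleftrightarrow>
     finite (verts G) \<and> finite (edges G) \<and>
     (\<forall>e\<in>edges G. \<exists>g. arc g \<and> path_image g = e \<and> e \<inter> verts G = {pathstart g, pathfinish g}) \<and>
     (\<forall>e\<in>edges G. \<forall>f\<in>edges G. e \<noteq> f \<longrightarrow> e \<inter> f \<subseteq> verts G)"

definition induced :: "drawn_graph \<Rightarrow> complex set \<Rightarrow> drawn_graph" where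
  "induced G W = \<lparr>verts = verts G \<inter> W, edges = {e \<in> edges G. e \<inter> verts G \<subseteq> W}\<rparr>"

definition remove_verts :: "drawn_graph \<Rightarrow> complex set \<Rightarrow> drawn_graph" where
  "remove_verts G S = induced G (verts G - S)"

definition faces :: "drawn_graph \<Rightarrow> complex set set" where
  "faces G = components (- (verts G \<union> \<Union>(edges G)))"

text \<open>The points \<open>a 1, \<dots>, a n\<close> appear in this cyclic order (in one of the two orientations) on
  the face \<open>F\<close>: some closed disc, contained in \<open>F\<close> except for these points, has them in this order
  on its boundary curve \<open>c\<close>. When the boundary of \<open>F\<close> is connected, such a disc is a thin strip
  running along the facial walk from \<open>a 1\<close> to \<open>a n\<close>, so that this is the order of (suitable
  occurrences of) the points in that walk, also when the walk passes several times through a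
  cut vertex. It is essential that the whole disc, and not only its boundary curve,
  lies in \<open>F\<close>: for two disjoint edges \<open>uv\<close> and \<open>xy\<close> some simple closed curve passes through
  \<open>u, x, v, y\<close> in this order and otherwise avoids the edges, one of them being inside and the
  other one outside.\<close>

definition cyclic_order_on_face :: "complex set \<Rightarrow> nat \<Rightarrow> (nat \<Rightarrow> complex) \<Rightarrow> bool" where
  "cyclic_order_on_face F n a \<longleftrightarrow>
     (\<exists>c t. simple_path c \<and> pathfinish c = pathstart c \<and>
        path_image c \<union> inside (path_image c) - a ` {1..n} \<subseteq> F \<and>
        t ` {1..n} \<subseteq> {0..<1} \<and> strict_mono_on {1..n} t \<and>
        (\<forall>i\<in>{1..n}. c (t i) = a i))"

section \<open>Perfect matchings\<close>

definition perfect_matching :: "drawn_graph \<Rightarrow> complex set set \<Rightarrow> bool" where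
  "perfect_matching G M \<longleftrightarrow> M \<subseteq> edges G \<and> (\<forall>v\<in>verts G. \<exists>!e. e \<in> M \<and> v \<in> e)"

definition num_pm :: "drawn_graph \<Rightarrow> nat" where
  "num_pm G = card {M. perfect_matching G M}"

section \<open>Pfaffians\<close>

definition pairings :: "nat \<Rightarrow> nat set set set" where
  "pairings n = {P. partition_on {1..n} P \<and> (\<forall>p\<in>P. card p = 2)}"

text \<open>The inequalities make each crossing pair of pairs correspond to a single quadruple.\<close>

definition crossings :: "nat set set \<Rightarrow> nat" where
  "crossings P = card {(a, b, c, d). {a, b} \<in> P \<and> {c, d} \<in> P \<and> a < c \<and> c < b \<and> b < d}"

definition pfaffian :: "nat \<Rightarrow> (nat \<Rightarrow> nat \<Rightarrow> 'a::comm_ring_1) \<Rightarrow> 'a" where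
  "pfaffian n m = (\<Sum>P\<in>pairings n. (-1) ^ crossings P * (\<Prod>p\<in>P. m (Min p) (Max p)))"

section \<open>The subgraphs indexed by pairs\<close>

definition H_sub ::
  "drawn_graph \<Rightarrow> complex set \<Rightarrow> complex set \<Rightarrow> complex \<Rightarrow> complex \<Rightarrow> drawn_graph" where
  "H_sub G AK AH x y =
     (let H = remove_verts G AK in
      if x \<in> AK \<and> y \<in> AK then induced G (verts H \<union> {x, y})
      else if x \<in> AK \<and> y \<in> AH then induced G ((verts H - {y}) \<union> {x})
      else if x \<in> AH \<and> y \<in> AK then induced G ((verts H - {x}) \<union> {y})
      else remove_verts H {x, y})"

end

theory Submission
  imports Defs
begin

text \<open>Write \<open>w S\<close> for the number of perfect matchings of the graph obtained from \<open>H\<close> by toggling the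
  membership of the terminals in \<open>S \<subseteq> A\<close>. Superposing two matchings counted by \<open>w S\<^sub>1\<close> and \<open>w S\<^sub>2\<close>, with
  \<open>S\<close> the disjoint union of \<open>S\<^sub>1\<close> and \<open>S\<^sub>2\<close>, gives cycles and paths that connect the elements of \<open>S\<close> in
  pairs. By planarity these paths do not cross, so the ends of a path are separated by an even number
  of terminals of \<open>S\<close>. Exchanging the matchings along one path gives the condensation identity
  \<open>w {} * w S = (\<Sum>j. \<plusminus> w {i\<^sub>0, j} * w (S - {i\<^sub>0, j}))\<close>, with \<open>i\<^sub>0\<close> the first element of \<open>S\<close>. As
  \<open>w {} = 1\<close>, this is the expansion of a Pfaffian along its first row.\<close>

section \<open>Disjoint connections outside a closed curve\<close>

text \<open>Not every point of \<open>c\<close> is known to be accessible from the inside, so the inside is cut into two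
  halves by an arc \<open>g\<close> between accessible points \<open>c s1\<close> and \<open>c s3\<close> close to \<open>c t1\<close> and \<open>c t3\<close>. Together with \<open>p\<close>
  and two short pieces of \<open>c\<close> it forms a simple closed curve \<open>J\<close>. If \<open>p\<close> and \<open>Q\<close> were disjoint, \<open>Q\<close> would
  connect the two halves in the complement of \<open>J\<close>; but near an interior point of \<open>g\<close> both sides of
  \<open>J\<close> are met.\<close>

lemma interlaced_outside_loop_meet:
  fixes c p :: "real \<Rightarrow> complex"
  assumes c: "simple_path c" "pathfinish c = pathstart c"
    and p: "arc p" "pathstart p = c t1" "pathfinish p = c t3"
    and Q: "connected Q" "c t2 \<in> Q" "c t4 \<in> Q"
    and fin: "finite (path_image c \<inter> (path_image p \<union> Q))"
    and ins: "inside (path_image c) \<inter> (path_image p \<union> Q) = {}"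
    and t: "0 \<le> t1" "t1 < t2" "t2 < t3" "t3 < t4" "t4 < 1"
  shows "path_image p \<inter> Q \<noteq> {}"
proof
  assume disj: "path_image p \<inter> Q = {}"
  define D where "D = inside (path_image c)"
  have jc: "open D" "connected D" "frontier D = path_image c" "D \<inter> path_image c = {}"
    using Jordan_inside_outside[OF c] inside_no_overlap[of "path_image c"] unfolding D_def by auto
  have c10: "c 1 = c 0"
    using c(2) by (simp add: pathstart_def pathfinish_def)
  have inj: "x = y" if "c x = c y" "0 \<le> x" "x < 1" "0 \<le> y" "y < 1" for x y
    using c(1) that unfolding simple_path_def loop_free_def by fastforce
  have injc: "x = y \<or> y = 1 \<and> x = 0" if "c x = c y" "0 \<le> x" "x < 1" "0 \<le> y" "y \<le> 1" for x y
    using inj[of x y] inj[of x 0] that c10 by (cases "y = 1") auto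
  \<comment> \<open>The parameters at which \<open>c\<close> meets \<open>p\<close> or
    \<open>Q\<close>. As there are finitely many, short parameter intervals just after
    \<open>t1\<close> and \<open>t3\<close> contain none of them.\<close>
  define B where "B = {x \<in> {0..<1}. c x \<in> path_image p \<union> Q}"
  have "finite B"
  proof (rule finite_imageD)
    show "finite (c ` B)"
      by (rule finite_subset[OF _ fin]) (auto simp: B_def path_image_def)
    show "inj_on c B"
      using inj by (auto simp: inj_on_def B_def)
  qed
  obtain e1 where e1: "e1 > 0" "\<forall>x\<in>B. x \<noteq> t1 \<longrightarrow> e1 \<le> dist t1 x"
    using finite_set_avoid[OF \<open>finite B\<close>] by blast
  obtain e3 where e3: "e3 > 0" "\<forall>x\<in>B. x \<noteq> t3 \<longrightarrow> e3 \<le> dist t3 x"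
    using finite_set_avoid[OF \<open>finite B\<close>] by blast
  \<comment> \<open>The bounds \<open>t2\<close> and \<open>t4\<close> guarantee the order
    \<open>t1 < s1 < t2 < t3 < s3 < t4\<close> for the parameters chosen below.\<close>
  define u1 where "u1 = min (t1 + e1) t2"
  define u3 where "u3 = min (t3 + e3) t4"
  have u: "t1 < u1" "u1 \<le> t2" "t3 < u3" "u3 \<le> t4"
    using e1 e3 t by (auto simp: u1_def u3_def)
  have free1: "c x \<notin> path_image p \<union> Q" if "t1 < x" "x < u1" for x
    using e1(2) that u t unfolding B_def u1_def dist_real_def by fastforce
  have free3: "c x \<notin> path_image p \<union> Q" if "t3 < x" "x < u3" for x
    using e3(2) that u t unfolding B_def u3_def dist_real_def by fastforce
  have contc: "continuous_on {0..1} c"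
    using c(1) by (simp add: simple_path_def path_def)
  have openc: "openin (top_of_set (frontier D)) (c ` {x<..<y})" if xy: "0 \<le> x" "x < y" "y \<le> 1" for x y
  proof -
    have "compact (c ` ({0..x} \<union> {y..1}))"
      using xy by (intro compact_continuous_image continuous_on_subset[OF contc] compact_Un) auto
    moreover have "c ` {x<..<y} = path_image c - c ` ({0..x} \<union> {y..1})"
    proof (intro equalityI subsetI)
      fix z assume "z \<in> c ` {x<..<y}"
      then obtain w where w: "z = c w" "x < w" "w < y" by auto
      have "z \<notin> c ` ({0..x} \<union> {y..1})"
        using injc[of w] w xy by fastforce
      then show "z \<in> path_image c - c ` ({0..x} \<union> {y..1})"
        using w xy by (auto simp: path_image_def)
    next
      fix z assume "z \<in> path_image c - c ` ({0..x} \<union> {y..1})"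
      then show "z \<in> c ` {x<..<y}"
        unfolding path_image_def by (force simp: image_iff not_le)
    qed
    ultimately show ?thesis
      unfolding jc using compact_imp_closed
      by (metis Diff_eq inf_commute open_Compl openin_open_Int)
  qed
  have "c ((t1 + u1) / 2) \<notin> c ` {t3<..<u3}"
    using inj[of "(t1 + u1) / 2"] u t by fastforce
  moreover have "c ((t1 + u1) / 2) \<in> c ` {t1<..<u1}"
    using u by auto
  ultimately have "c ` {t1<..<u1} \<noteq> c ` {t3<..<u3}" by metis
  moreover have "c ` {t1<..<u1} \<noteq> {}" "c ` {t3<..<u3} \<noteq> {}"
    using u by auto
  \<comment> \<open>Pairs of accessible points exist in any two distinct nonempty relatively open
    parts of the frontier; \<open>openc\<close> and the preceding inequality of the two pieces serve
    this purpose.\<close>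
  ultimately obtain g where g: "arc g" "pathstart g \<in> c ` {t1<..<u1}" "pathfinish g \<in> c ` {t3<..<u3}"
      "g ` {0<..<1} \<subseteq> D"
    using dense_accessible_frontier_point_pairs[OF jc(1,2) openc[of t1 u1] openc[of t3 u3]] u t by auto
  obtain s1 where s1: "pathstart g = c s1" "t1 < s1" "s1 < u1" using g(2) by auto
  obtain s3 where s3: "pathfinish g = c s3" "t3 < s3" "s3 < u3" using g(3) by auto
  note ord = t u s1(2,3) s3(2,3)
  have img: "path_image g - {c s1, c s3} = g ` {0<..<1}"
    using simple_path_endless[OF arc_imp_simple_path[OF g(1)]] s1 s3 by simp
  have gc: "path_image g \<inter> path_image c = {c s1, c s3}"
  proof -
    have "c s1 \<in> path_image c" "c s3 \<in> path_image c"
      using ord by (auto simp: path_image_def)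
    moreover have "c s1 \<in> path_image g" "c s3 \<in> path_image g"
      using s1 s3 by (metis pathstart_in_path_image pathfinish_in_path_image)+
    ultimately show ?thesis using img g(4) jc(4) by auto
  qed
  have gsub: "path_image g \<subseteq> D \<union> {c s1, c s3}"
    using img g(4) by auto
  have ne: "c s1 \<noteq> c s3" using inj[of s1 s3] ord by auto
  \<comment> \<open>\<open>c1\<close> carries \<open>c t2\<close>, while \<open>c2\<close>, which
    runs through the base point \<open>c 0 = c 1\<close>, carries \<open>c t4\<close>.\<close>
  define c1 where "c1 = subpath s1 s3 c"
  define c2 where "c2 = subpath s1 0 c +++ subpath 1 s3 c"
  have jn: "pathfinish (subpath s1 0 c) = pathstart (subpath 1 s3 c)"
    using c10 by simp
  have c1: "simple_path c1" "pathstart c1 = c s1" "pathfinish c1 = c s3" "path_image c1 = c ` {s1..s3}"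
    unfolding c1_def using ord c(1) by (auto intro!: simple_path_subpath simp: path_image_subpath)
  have c2i: "path_image c2 = c ` {0..s1} \<union> c ` {s3..1}"
    unfolding c2_def using ord by (simp add: path_image_join[OF jn] path_image_subpath)
  have c2: "simple_path c2" "pathstart c2 = c s1" "pathfinish c2 = c s3"
  proof -
    have "arc (subpath s1 0 c)" "arc (subpath 1 s3 c)"
      using ord by (auto intro!: arc_simple_path_subpath_interior[OF c(1)])
    moreover have "path_image (subpath s1 0 c) \<inter> path_image (subpath 1 s3 c) \<subseteq> {pathstart (subpath 1 s3 c)}"
    proof
      fix z assume "z \<in> path_image (subpath s1 0 c) \<inter> path_image (subpath 1 s3 c)"
      then have "z \<in> c ` {0..s1}" "z \<in> c ` {s3..1}"
        using ord by (auto simp: path_image_subpath)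
      then obtain x y where "z = c x" "z = c y" "0 \<le> x" "x \<le> s1" "s3 \<le> y" "y \<le> 1"
        by fastforce
      then show "z \<in> {pathstart (subpath 1 s3 c)}"
        using injc[of x y] ord by auto
    qed
    ultimately have "arc c2" unfolding c2_def using jn by (intro arc_join) auto
    then show "simple_path c2" by (rule arc_imp_simple_path)
  qed (auto simp: c2_def)
  have c12: "path_image c1 \<union> path_image c2 = path_image c"
  proof -
    have "{s1..s3} \<union> ({0..s1} \<union> {s3..1}) = {0..1}" using ord by auto
    then show ?thesis
      unfolding c1 c2i by (metis image_Un path_image_def)
  qed
  have c12i: "path_image c1 \<inter> path_image c2 = {c s1, c s3}"
  proof (intro equalityI subsetI)
    fix z assume "z \<in> path_image c1 \<inter> path_image c2"
    then have "z \<in> c ` {s1..s3}" "z \<in> c ` ({0..s1} \<union> {s3..1})"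
      unfolding c1 c2i by auto
    then obtain x y where "z = c x" "z = c y" "s1 \<le> x" "x \<le> s3" "0 \<le> y \<and> y \<le> s1 \<or> s3 \<le> y \<and> y \<le> 1"
      by fastforce
    then show "z \<in> {c s1, c s3}"
      using injc[of x y] ord by auto
  next
    fix z assume "z \<in> {c s1, c s3}"
    then show "z \<in> path_image c1 \<inter> path_image c2"
      unfolding c1 c2i using ord by auto
  qed
  have c1g: "path_image c1 \<inter> path_image g = {c s1, c s3}"
    and c2g: "path_image c2 \<inter> path_image g = {c s1, c s3}"
    using gc c12 c12i by auto
  have half: "g (1/2) \<in> D" "g (1/2) \<in> path_image g"
    using g(4) by (auto simp: path_image_def)
  define D1 where "D1 = inside (path_image c1 \<union> path_image g)"
  define D2 where "D2 = inside (path_image c2 \<union> path_image g)"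
  have "path_image g \<inter> inside (path_image c1 \<union> path_image c2) \<noteq> {}"
    unfolding c12 D_def[symmetric] using half by blast
  from split_inside_simple_closed_curve[OF c1(1-3) c2 arc_imp_simple_path[OF g(1)] s1(1) s3(1) ne c12i c1g c2g this]
  have D12: "D1 \<union> D2 \<union> (path_image g - {c s1, c s3}) = D"
    unfolding D1_def D2_def c12 D_def by metis
  \<comment> \<open>Each half is the inside of a simple closed curve formed by one piece of
    \<open>c\<close> and by \<open>g\<close>, so the Jordan curve theorem makes it connected and
    determines its frontier.\<close>
  have lens: "simple_path (d +++ reversepath g) \<and> pathfinish (d +++ reversepath g) = pathstart (d +++ reversepath g)
      \<and> path_image (d +++ reversepath g) = path_image d \<union> path_image g"
    if d: "simple_path d" "pathstart d = c s1" "pathfinish d = c s3"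
      "path_image d \<inter> path_image g = {c s1, c s3}" for d
    using d s1(1) s3(1) g(1) ne simple_path_imp_arc[OF d(1)]
    by (auto simp: path_image_join intro!: simple_path_join_loop arc_reversepath)
  have D1: "connected D1" "frontier D1 = path_image c1 \<union> path_image g" "D1 \<inter> (path_image c1 \<union> path_image g) = {}"
    using lens[OF c1(1-3) c1g] Jordan_inside_outside[of "c1 +++ reversepath g"]
      inside_no_overlap[of "path_image c1 \<union> path_image g"]
    unfolding D1_def by auto
  have D2: "connected D2" "frontier D2 = path_image c2 \<union> path_image g" "D2 \<inter> (path_image c2 \<union> path_image g) = {}"
    using lens[OF c2 c2g] Jordan_inside_outside[of "c2 +++ reversepath g"]
      inside_no_overlap[of "path_image c2 \<union> path_image g"]
    unfolding D2_def by auto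
  \<comment> \<open>A connection from \<open>c t1\<close> to \<open>c t3\<close> through the inside.
    Apart from \<open>g\<close> and its own two end points it uses only points of \<open>c\<close>
    that \<open>free1\<close> and \<open>free3\<close> keep away from \<open>p\<close> and
    \<open>Q\<close>.\<close>
  define k where "k = subpath t1 s1 c +++ (g +++ subpath s3 t3 c)"
  have kjoin: "pathfinish (subpath t1 s1 c) = pathstart (g +++ subpath s3 t3 c)"
     "pathfinish g = pathstart (subpath s3 t3 c)" using s1 s3 by auto
  have ki: "path_image k = c ` {t1..s1} \<union> path_image g \<union> c ` {t3..s3}"
    unfolding k_def using ord kjoin by (auto simp: path_image_join path_image_subpath)
  have gci: "z = c s1 \<or> z = c s3" if "z \<in> path_image g" "z = c x" "0 \<le> x" "x \<le> 1" for z x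
  proof -
    have "z \<in> path_image c" using that unfolding path_image_def by auto
    then show ?thesis using gc that by blast
  qed
  have arck: "arc k"
  proof -
    have a: "arc (subpath t1 s1 c)" "arc (subpath s3 t3 c)"
      using ord by (auto intro!: arc_simple_path_subpath_interior[OF c(1)])
    have "path_image g \<inter> path_image (subpath s3 t3 c) \<subseteq> {pathstart (subpath s3 t3 c)}"
    proof
      fix z assume "z \<in> path_image g \<inter> path_image (subpath s3 t3 c)"
      then obtain x where x: "z \<in> path_image g" "z = c x" "t3 \<le> x" "x \<le> s3"
        using ord by (auto simp: path_image_subpath)
      have "c x \<noteq> c s1" using inj[of x s1] x ord by auto
      then show "z \<in> {pathstart (subpath s3 t3 c)}"
        using gci[OF x(1,2)] x ord by auto
    qed
    then have "arc (g +++ subpath s3 t3 c)"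
      using a g kjoin by (intro arc_join) auto
    moreover have "path_image (subpath t1 s1 c) \<inter> path_image (g +++ subpath s3 t3 c) \<subseteq> {pathstart (g +++ subpath s3 t3 c)}"
    proof
      fix z assume "z \<in> path_image (subpath t1 s1 c) \<inter> path_image (g +++ subpath s3 t3 c)"
      then have "z \<in> c ` {t1..s1}" and zz: "z \<in> path_image g \<or> z \<in> c ` {t3..s3}"
        using ord kjoin by (auto simp: path_image_subpath path_image_join)
      then obtain x where x: "z = c x" "t1 \<le> x" "x \<le> s1" "z \<in> path_image g \<or> z \<in> c ` {t3..s3}"
        by fastforce
      have zy: "z \<noteq> c y" if "t3 \<le> y" "y \<le> s3" for y using inj[of x y] x ord that by auto
      have "z \<notin> c ` {t3..s3}" by (metis zy atLeastAtMost_iff imageE)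
      moreover have "z \<noteq> c s3" using zy[of s3] ord by simp
      ultimately have "z = c s1" using gci[of z x] x ord zz by auto
      then show "z \<in> {pathstart (g +++ subpath s3 t3 c)}"
        using s1(1) by simp
    qed
    ultimately show ?thesis
      unfolding k_def using a kjoin by (blast intro: arc_join)
  qed
  have pD: "path_image p \<inter> D = {}" "Q \<inter> D = {}" using ins D_def by auto
  have kp: "path_image k \<inter> path_image p \<subseteq> {c t1, c t3}"
  proof
    fix z assume z: "z \<in> path_image k \<inter> path_image p"
    then consider x where "z = c x" "t1 \<le> x" "x \<le> s1" | x where "z = c x" "t3 \<le> x" "x \<le> s3"
      using ki gsub pD ord by fastforce
    then show "z \<in> {c t1, c t3}"
    proof cases
      case 1 then show ?thesis using free1[of x] z ord by (cases "x = t1") auto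
    next
      case 2 then show ?thesis using free3[of x] z ord by (cases "x = t3") auto
    qed
  qed
  define J where "J = path_image k \<union> path_image p"
  have kends: "pathstart k = c t1" "pathfinish k = c t3" unfolding k_def by auto
  have "simple_path (k +++ reversepath p)"
    using arck p kends kp by (intro simple_path_join_loop) (auto simp: arc_reversepath)
  moreover have "pathfinish (k +++ reversepath p) = pathstart (k +++ reversepath p)"
    "path_image (k +++ reversepath p) = J"
    using p kends by (auto simp: path_image_join J_def)
  ultimately have J: "open (inside J)" "open (outside J)" "inside J \<inter> outside J = {}"
     "inside J \<union> outside J = - J" "frontier (inside J) = J" "frontier (outside J) = J"
    using Jordan_inside_outside[of "k +++ reversepath p"] by auto
  have cD: "c x \<notin> D" if "0 \<le> x" "x \<le> 1" for x
    using jc(4) that by (auto simp: path_image_def)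
  \<comment> \<open>The points of \<open>k\<close> on \<open>c\<close> not covered by
    \<open>free1\<close> and \<open>free3\<close> are \<open>c t1\<close> and \<open>c t3\<close>.
    They lie on \<open>p\<close>, hence not in \<open>Q\<close>.\<close>
  have JQ: "J \<inter> Q = {}"
  proof (rule ccontr)
    assume "J \<inter> Q \<noteq> {}"
    then obtain z where z: "z \<in> J" "z \<in> Q" by auto
    then have zp: "z \<notin> path_image p" using disj by auto
    then consider x where "z = c x" "t1 \<le> x" "x \<le> s1" | x where "z = c x" "t3 \<le> x" "x \<le> s3"
      using z ki gsub pD ord unfolding J_def by fastforce
    then show False
    proof cases
      case 1
      have "c t1 \<in> path_image p" using p by (metis pathstart_in_path_image)
      then show ?thesis using free1[of x] z zp ord 1 by (cases "x = t1") auto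
    next
      case 2
      have "c t3 \<in> path_image p" using p by (metis pathfinish_in_path_image)
      then show ?thesis using free3[of x] z zp ord 2 by (cases "x = t3") auto
    qed
  qed
  have D12D: "D1 \<subseteq> D" "D2 \<subseteq> D" using D12 by auto
  have DJ: "D \<inter> J \<subseteq> path_image g"
    unfolding J_def ki using pD cD ord by auto
  have "(D1 \<union> D2) \<inter> J = {}" using DJ D12D D1(3) D2(3) by blast
  have "c t2 \<in> frontier D1" "c t4 \<in> frontier D2"
    unfolding D1 D2 c1 c2i using ord by auto
  then have cl: "c t2 \<in> closure D1" "c t4 \<in> closure D2"
    by (auto simp: frontier_def)
  have "connected (insert (c t2) D1)" "connected (insert (c t4) D2)"
    using cl connected_intermediate_closure[OF D1(1), of "insert (c t2) D1"]
      connected_intermediate_closure[OF D2(1), of "insert (c t4) D2"]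
      closure_subset[of D1] closure_subset[of D2] by auto
  then have "connected ((insert (c t2) D1 \<union> Q) \<union> insert (c t4) D2)"
    using Q by (intro connected_Un) auto
  \<comment> \<open>\<open>Q\<close> bridges the two halves, attached at the frontier points
    \<open>c t2\<close> of \<open>D1\<close> and \<open>c t4\<close> of \<open>D2\<close>.\<close>
  moreover define X where "X = (insert (c t2) D1 \<union> Q) \<union> insert (c t4) D2"
  ultimately have "connected X" by simp
  have XJ: "X \<inter> J = {}" using JQ \<open>(D1 \<union> D2) \<inter> J = {}\<close> Q by (auto simp: X_def)
  have gJ: "g (1/2) \<in> J" using half by (auto simp: J_def ki)
  \<comment> \<open>Used for both sides of \<open>J\<close>: each has \<open>g (1/2)\<close> in its
    closure and therefore meets the open set \<open>D\<close>, whose points off \<open>g\<close> all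
    lie in \<open>D1\<close> or \<open>D2\<close>.\<close>
  have "\<exists>y. y \<in> W \<inter> X" if W: "open W" "frontier W = J" "W \<inter> J = {}" for W
  proof -
    have "g (1/2) \<in> closure W" using gJ W by (auto simp: frontier_def)
    then have "D \<inter> W \<noteq> {}"
      using jc(1) half by (metis disjoint_iff open_Int_closure_eq_empty)
    then obtain y where y: "y \<in> D" "y \<in> W" by auto
    then have "y \<notin> path_image g"
      using W(3) by (auto simp: J_def ki)
    then have "y \<in> X" using D12 y by (auto simp: X_def)
    then show ?thesis using y by auto
  qed
  from this[of "inside J"] this[of "outside J"]
  have "inside J \<inter> X \<noteq> {}" "outside J \<inter> X \<noteq> {}" using J by auto
  moreover have "X \<subseteq> inside J \<union> outside J" using XJ J by auto
  moreover have "inside J \<inter> outside J \<inter> X = {}" using J by auto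
  ultimately show False
    using \<open>connected X\<close> J(1,2) unfolding connected_def by blast
qed

section \<open>Superposition of matchings\<close>

text \<open>Prescribing degree 0 outside \<open>W\<close> expresses perfect matchings of an induced
  subgraph within the fixed graph, so that matchings of different subgraphs can be
  superposed.\<close>

definition matchings :: "'v set \<Rightarrow> 'v set set \<Rightarrow> 'v set \<Rightarrow> 'v set set set" where
  "matchings V E W = {M. M \<subseteq> E \<and> (\<forall>v\<in>V. card {e \<in> M. v \<in> e} = of_bool (v \<in> W))}"

text \<open>The pair \<open>flip C N N'\<close>, \<open>flip C N' N\<close> arises from
  \<open>N\<close>, \<open>N'\<close> by exchanging the edges that touch \<open>C\<close>. The
  exchange is undone by repeating it and preserves the union, hence the components.\<close>

definition flip :: "'v set \<Rightarrow> 'v set set \<Rightarrow> 'v set set \<Rightarrow> 'v set set" where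
  "flip C N N' = {e \<in> N. e \<inter> C = {}} \<union> {e \<in> N'. e \<inter> C \<noteq> {}}"

lemma flip_flip: "flip C (flip C N N') (flip C N' N) = N"
  unfolding flip_def by blast

lemma flip_Un: "flip C N N' \<union> flip C N' N = N \<union> N'"
  unfolding flip_def by blast

text \<open>As for arcs in the plane, an edge may contain points that are not vertices. Its ends are
  the elements of \<open>e \<inter> V\<close>, and different edges may share both ends.\<close>

locale multigraph =
  fixes V :: "'v set" and E :: "'v set set"
  assumes finite_V: "finite V" and finite_E: "finite E"
    and card_ends: "e \<in> E \<Longrightarrow> card (e \<inter> V) = 2"
begin

definition component :: "'v set set \<Rightarrow> 'v \<Rightarrow> 'v set" where
  "component L s = {(x, y). x \<in> V \<and> y \<in> V \<and> (\<exists>e\<in>L. x \<in> e \<and> y \<in> e)}\<^sup>* `` {s}"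

lemma component_self: "s \<in> component L s"
  by (simp add: component_def)

lemma component_induct [consumes 1, case_names self step]:
  assumes "v \<in> component L s"
    and "P s"
    and "\<And>x y e. x \<in> component L s \<Longrightarrow> P x \<Longrightarrow> e \<in> L \<Longrightarrow> x \<in> e \<inter> V \<Longrightarrow> y \<in> e \<inter> V \<Longrightarrow> P y"
  shows "P v"
proof -
  have "(s, v) \<in> {(x, y). x \<in> V \<and> y \<in> V \<and> (\<exists>e\<in>L. x \<in> e \<and> y \<in> e)}\<^sup>*"
    using assms(1) by (simp add: component_def)
  then show ?thesis
    by (induction rule: rtrancl_induct) (use assms(2,3) in \<open>auto simp: component_def\<close>)
qed

lemma component_subset: "s \<in> V \<Longrightarrow> component L s \<subseteq> V"
proof
  fix v assume "v \<in> component L s" "s \<in> V"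
  then show "v \<in> V" by (induction rule: component_induct) auto
qed

lemma component_edge:
  assumes "e \<in> L" "v \<in> e" "v \<in> V" "v \<in> component L s"
  shows "e \<inter> V \<subseteq> component L s"
  using assms unfolding component_def by (force intro: rtrancl_into_rtrancl)

lemma component_eq:
  assumes "v \<in> component L s"
  shows "component L v = component L s"
proof -
  let ?R = "{(x, y). x \<in> V \<and> y \<in> V \<and> (\<exists>e\<in>L. x \<in> e \<and> y \<in> e)}"
  have "sym (?R\<^sup>*)" by (intro sym_rtrancl) (auto simp: sym_def)
  then have "(v, s) \<in> ?R\<^sup>*" "(s, v) \<in> ?R\<^sup>*"
    using assms by (auto simp: component_def sym_def)
  then show ?thesis
    unfolding component_def by (auto intro: rtrancl_trans)
qed

text \<open>An edge of the superposition that touches \<open>C\<close> has all its ends in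
  \<open>C\<close>. So the edges at a vertex all come from \<open>N'\<close> if the vertex lies in
  \<open>C\<close>, and all from \<open>N\<close> otherwise.\<close>

lemma flip_matching:
  assumes N: "N \<in> matchings V E A" and N': "N' \<in> matchings V E B" and s: "s \<in> V"
    and C: "C = component (N \<union> N') s"
  shows "flip C N N' \<in> matchings V E ((A - C) \<union> (B \<inter> C))"
proof -
  have "{e \<in> flip C N N'. v \<in> e} = (if v \<in> C then {e \<in> N'. v \<in> e} else {e \<in> N. v \<in> e})"
    if v: "v \<in> V" for v
  proof -
    have "v \<in> C" if e: "e \<in> N \<union> N'" "e \<inter> C \<noteq> {}" "v \<in> e" for e
    proof -
      obtain x where "x \<in> e" "x \<in> C" using e by auto
      then show ?thesis
        using e v component_subset[OF s] component_edge[of e "N \<union> N'" x s] unfolding C by auto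
    qed
    then show ?thesis
      unfolding flip_def by auto
  qed
  then show ?thesis
    using N N' unfolding matchings_def flip_def by auto
qed

text \<open>Take a maximal \<open>U\<close> that contains \<open>s\<close> and has at most one
  vertex more than it has edges inside. If \<open>U\<close> were not the whole component, an edge
  leaving it would add one vertex and at least one inner edge.\<close>

lemma card_component_le:
  assumes "L \<subseteq> E" "s \<in> V"
  shows "card (component L s) \<le> card {e \<in> L. e \<inter> component L s \<noteq> {}} + 1"
proof -
  let ?C = "component L s"
  define \<U> where "\<U> = {U. s \<in> U \<and> U \<subseteq> ?C \<and> card U \<le> card {e \<in> L. e \<inter> V \<subseteq> U} + 1}"
  have finL: "finite L" using assms finite_E finite_subset by blast
  have finC: "finite ?C" using component_subset[OF assms(2)] finite_V finite_subset by blast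
  have "finite \<U>" using finC unfolding \<U>_def by simp
  moreover have "{s} \<in> \<U>" using component_self by (auto simp: \<U>_def)
  ultimately obtain U where U: "U \<in> \<U>" "\<And>U'. U' \<in> \<U> \<Longrightarrow> U \<subseteq> U' \<Longrightarrow> U = U'"
    using finite_has_maximal[of \<U>] by blast
  have UC: "U \<subseteq> ?C" "s \<in> U" and cU: "card U \<le> card {e \<in> L. e \<inter> V \<subseteq> U} + 1"
    using U by (auto simp: \<U>_def)
  have "v \<in> U" if "v \<in> ?C" for v
    using that
  proof (induction rule: component_induct)
    case (step x y e)
    show ?case
    proof (rule ccontr)
      assume y: "y \<notin> U"
      have "{x, y} \<subseteq> e \<inter> V" "x \<noteq> y" "card (e \<inter> V) = 2" "finite (e \<inter> V)"
        using step y card_ends assms finite_V by auto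
      then have ends: "e \<inter> V = {x, y}"
        by (metis card_2_iff card_subset_eq)
      have "insert e {e \<in> L. e \<inter> V \<subseteq> U} \<subseteq> {e \<in> L. e \<inter> V \<subseteq> insert y U}"
        using ends step by auto
      then have "card (insert e {e \<in> L. e \<inter> V \<subseteq> U}) \<le> card {e \<in> L. e \<inter> V \<subseteq> insert y U}"
        using finL by (intro card_mono) auto
      moreover have "e \<notin> {e \<in> L. e \<inter> V \<subseteq> U}" using ends y by auto
      moreover have "finite U" using UC finC finite_subset by blast
      ultimately have "card (insert y U) \<le> card {e \<in> L. e \<inter> V \<subseteq> insert y U} + 1"
        using cU y finL by simp
      moreover have "y \<in> ?C" using component_edge[of e L x s] step by auto
      ultimately have "insert y U \<in> \<U>" using UC by (auto simp: \<U>_def)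
      then show False using U(2)[of "insert y U"] y by auto
    qed
  qed (use UC in auto)
  then have "U = ?C" using UC by auto
  moreover have "card {e \<in> L. e \<inter> V \<subseteq> ?C} \<le> card {e \<in> L. e \<inter> ?C \<noteq> {}}"
  proof (intro card_mono subsetI)
    fix e assume "e \<in> {e \<in> L. e \<inter> V \<subseteq> ?C}"
    then have "e \<in> L" "e \<inter> V \<subseteq> ?C" "e \<inter> V \<noteq> {}"
      using card_ends[of e] assms by force+
    then show "e \<in> {e \<in> L. e \<inter> ?C \<noteq> {}}" by auto
  qed (use finL in auto)
  ultimately show ?thesis using cU by auto
qed

text \<open>Handshake lemma by double counting: an edge of \<open>N\<close> that touches the
  component has both its ends there.\<close>

lemma sum_degrees_component:
  assumes "N \<subseteq> L" "L \<subseteq> E" "s \<in> V"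
  shows "(\<Sum>v\<in>component L s. card {e \<in> N. v \<in> e}) = 2 * card {e \<in> N. e \<inter> component L s \<noteq> {}}"
proof -
  let ?C = "component L s" and ?N = "{e \<in> N. e \<inter> component L s \<noteq> {}}"
  have "finite N" using finite_E assms finite_subset by (metis order_trans)
  then have fin: "finite ?C" "finite ?N"
    using finite_subset[OF component_subset[OF assms(3)] finite_V] by auto
  have "(\<Sum>v\<in>?C. card {e \<in> ?N. v \<in> e}) = 2 * card ?N"
  proof (rule sum_multicount[OF fin], intro ballI)
    fix e assume e: "e \<in> ?N"
    then obtain x where "x \<in> e" "x \<in> ?C" "e \<in> L" using assms by auto
    then have "e \<inter> V \<subseteq> ?C"
      using component_subset[OF assms(3)] component_edge[of e L x s] by auto
    then have "{v \<in> ?C. v \<in> e} = e \<inter> V"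
      using component_subset[OF assms(3)] by auto
    then show "card {v \<in> ?C. v \<in> e} = 2"
      using card_ends e assms by auto
  qed
  moreover have "{e \<in> ?N. v \<in> e} = {e \<in> N. v \<in> e}" if "v \<in> ?C" for v
    using that by auto
  ultimately show ?thesis by simp
qed

text \<open>The degrees in the superposition are \<open>1\<close> on \<open>S\<close> and \<open>0\<close> or \<open>2\<close> elsewhere. By the handshake
  lemma a component has an even number of vertices in \<open>S\<close>, and by connectedness (at least
  \<open>|C| - 1\<close> edges) at most two.\<close>

lemma card_component_superposition:
  assumes N: "N \<in> matchings V E A" and N': "N' \<in> matchings V E B"
    and S: "S = {v \<in> V. v \<in> A \<longleftrightarrow> v \<notin> B}" and s: "s \<in> S"
  shows "card (component (N \<union> N') s \<inter> S) = 2"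
proof -
  let ?L = "N \<union> N'"
  let ?C = "component ?L s"
  let ?f = "\<lambda>v. of_bool (v \<in> A) + of_bool (v \<in> B) :: nat"
  have sV: "s \<in> V" using s unfolding S by blast
  have LE: "?L \<subseteq> E" using N N' unfolding matchings_def by blast
  have CV: "?C \<subseteq> V" by (rule component_subset[OF sV])
  then have finC: "finite ?C" using finite_V finite_subset by blast
  have finL: "finite ?L" using LE finite_E finite_subset by blast
  have "(\<Sum>v\<in>?C. card {e \<in> N. v \<in> e} + card {e \<in> N'. v \<in> e}) = (\<Sum>v\<in>?C. ?f v)"
    using CV N N' by (intro sum.cong refl) (auto simp: matchings_def subset_iff)
  then have sum: "(\<Sum>v\<in>?C. ?f v) = 2 * (card {e \<in> N. e \<inter> ?C \<noteq> {}} + card {e \<in> N'. e \<inter> ?C \<noteq> {}})"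
    using sum_degrees_component[of N ?L s] sum_degrees_component[of N' ?L s] LE sV by (simp add: sum.distrib)
  \<comment> \<open>An edge common to \<open>N\<close> and \<open>N'\<close> counts once in the
    union and twice in the degree sum, so only an inequality results; it has the direction
    required.\<close>
  have "{e \<in> ?L. e \<inter> C \<noteq> {}} = {e \<in> N. e \<inter> C \<noteq> {}} \<union> {e \<in> N'. e \<inter> C \<noteq> {}}" for C
    by blast
  then have "card {e \<in> ?L. e \<inter> ?C \<noteq> {}} \<le> card {e \<in> N. e \<inter> ?C \<noteq> {}} + card {e \<in> N'. e \<inter> ?C \<noteq> {}}"
    using card_Un_le by simp
  then have le: "2 * card ?C \<le> (\<Sum>v\<in>?C. ?f v) + 2"
    unfolding sum using card_component_le[OF LE sV] by simp
  have cS: "card (?C \<inter> S) = (\<Sum>v\<in>?C. of_bool (v \<in> S))"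
    using finC by (simp add: of_bool_def sum.If_cases)
  \<comment> \<open>At each vertex of the component the degree plus the indicator of
    \<open>S\<close> is 0 or 2. This gives the bound here and the parity below.\<close>
  have "(\<Sum>v\<in>?C. ?f v) + card (?C \<inter> S) \<le> (\<Sum>v\<in>?C. 2)"
    unfolding cS sum.distrib[symmetric] by (intro sum_mono) (auto simp: S)
  then have "card (?C \<inter> S) \<le> 2" using le by simp
  moreover have "even ((\<Sum>v\<in>?C. ?f v) + card (?C \<inter> S))"
    unfolding cS sum.distrib[symmetric] using CV by (intro dvd_sum) (auto simp: S)
  then have "even (card (?C \<inter> S))" using sum by simp
  moreover have "card (?C \<inter> S) > 0"
    using finC s component_self[of s ?L] by (auto simp: card_gt_0_iff)
  moreover have "x = 2" if "x \<le> 2" "even x" "x > 0" for x :: nat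
    using that by presburger
  ultimately show ?thesis by blast
qed

end

section \<open>Terminals joined in non-crossing pairs\<close>

definition num_between :: "nat set \<Rightarrow> nat \<Rightarrow> nat \<Rightarrow> nat" where
  "num_between I i j = card {k \<in> I. i < k \<and> k < j}"

text \<open>The form in which planarity enters the counting argument. The edge set \<open>L\<close>
  is arbitrary because it will be the union of two varying matchings.\<close>

locale noncrossing_terminals = multigraph V E for V :: "'v set" and E :: "'v set set" +
  fixes a :: "nat \<Rightarrow> 'v" and T :: "nat set"
  assumes inj_a: "inj_on a T" and a_V: "a ` T \<subseteq> V"
    and noncrossing: "\<lbrakk>L \<subseteq> E; {i, j, k, l} \<subseteq> T; i < j; j < k; k < l; a k \<in> component L (a i); a l \<in> component L (a j)\<rbrakk>
      \<Longrightarrow> a j \<in> component L (a i)"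
begin

text \<open>A pair with one member strictly between \<open>i\<close> and \<open>j\<close> and the
  other outside would interlace with \<open>{i, j}\<close>, forcing both pairs into one component.
  So the terminals in between form complete pairs.\<close>

lemma even_num_between:
  assumes L: "L \<subseteq> E" and I: "finite I" "I \<subseteq> T"
    and two: "\<And>i. i \<in> I \<Longrightarrow> card {k \<in> I. a k \<in> component L (a i)} = 2"
    and ij: "i \<in> I" "j \<in> I" "i < j" "a j \<in> component L (a i)"
  shows "even (num_between I i j)"
proof -
  let ?cl = "\<lambda>m. {k \<in> I. a k \<in> component L (a m)}"
  let ?B = "{k \<in> I. i < k \<and> k < j}"
  have cl_eq: "?cl m = {m, k}" if "m \<in> I" "k \<in> I" "a k \<in> component L (a m)" "m \<noteq> k" for m k
  proof (rule sym, rule card_subset_eq)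
    show "{m, k} \<subseteq> ?cl m" using that component_self by auto
    show "card {m, k} = card (?cl m)" using two[OF that(1)] that by simp
  qed (use I in auto)
  have sub: "?cl m \<subseteq> ?B" if m: "m \<in> ?B" for m
  proof
    fix k assume k: "k \<in> ?cl m"
    show "k \<in> ?B"
    proof (rule ccontr)
      assume "k \<notin> ?B"
      then have nk: "k \<le> i \<or> j \<le> k" "k \<noteq> m" using k m by auto
      have kI: "k \<in> I" "m \<in> I" "a k \<in> component L (a m)" using k m by auto
      have clm: "?cl m = {m, k}" using cl_eq[OF kI(2,1,3)] nk by auto
      have cli: "?cl i = {i, j}" using cl_eq[of i j] ij by auto
      have mi: "a m \<notin> component L (a i)" using cli m by auto
      have "k \<noteq> i" "k \<noteq> j" using mi component_eq[OF kI(3)] component_eq[OF ij(4)] component_self by metis+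
      then consider "k < i" | "j < k" using nk by linarith
      then show False
      proof cases
        case 1
        have "a m \<in> component L (a k)" using component_eq[OF kI(3)] component_self by metis
        then have "a i \<in> component L (a k)"
          using noncrossing[OF L, of k i m j] 1 m ij kI I by auto
        then have "a i \<in> component L (a m)" using component_eq[OF kI(3)] by simp
        then show False using mi component_eq component_self by metis
      next
        case 2
        then have "a m \<in> component L (a i)"
          using noncrossing[OF L, of i m j k] m ij kI I by auto
        then show False using mi by simp
      qed
    qed
  qed
  have "?B = \<Union> (?cl ` ?B)"
    using sub component_self by auto
  moreover have "2 dvd card (\<Union> (?cl ` ?B))"
  proof (rule dvd_partition)
    show "finite (\<Union> (?cl ` ?B))" using I by auto
    show "\<forall>c\<in>?cl ` ?B. 2 dvd card c" using two by auto
    show "\<forall>c1\<in>?cl ` ?B. \<forall>c2\<in>?cl ` ?B. c1 \<noteq> c2 \<longrightarrow> c1 \<inter> c2 = {}"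
      using component_eq by blast
  qed
  ultimately show ?thesis unfolding num_between_def by simp
qed

text \<open>With \<open>W\<close> the vertex set of \<open>H\<close>, these are the matchings
  counted by \<open>w X\<close>.\<close>

definition pms :: "'v set \<Rightarrow> nat set \<Rightarrow> 'v set set set" where
  "pms W X = matchings V E (sym_diff W (a ` X))"

text \<open>The other end of the path starting at terminal \<open>j\<close>. The description is
  unique when each component has exactly two or no terminals of \<open>I\<close>.\<close>

definition partner :: "nat set \<Rightarrow> 'v set set \<Rightarrow> nat \<Rightarrow> nat" where
  "partner I L j = (THE k. k \<in> I \<and> k \<noteq> j \<and> a k \<in> component L (a j))"

context
  fixes W :: "'v set" and I X Y :: "nat set" and N N' :: "'v set set"
  assumes W: "W \<subseteq> V" and I: "finite I" "I \<subseteq> T"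
    and XY: "X \<union> Y = I" "X \<inter> Y = {}"
    and N: "N \<in> pms W X" and N': "N' \<in> pms W Y"
begin

lemma card_class: 
  assumes "i \<in> I" shows "card {k \<in> I. a k \<in> component (N \<union> N') (a i)} = 2"
proof -
  have inj: "inj_on a I" using inj_a I inj_on_subset by blast
  have "a ` X \<inter> a ` Y = {}"
    using XY inj by (metis Un_upper1 Un_upper2 image_empty inj_on_image_Int)
  moreover have "a ` I = a ` X \<union> a ` Y" using XY by auto
  moreover have "a ` I \<subseteq> V" using I a_V by auto
  ultimately have "a ` I = {v \<in> V. v \<in> sym_diff W (a ` X) \<longleftrightarrow> v \<notin> sym_diff W (a ` Y)}"
    by blast
  then have "card (component (N \<union> N') (a i) \<inter> a ` I) = 2"
    using card_component_superposition N N' assms unfolding pms_def by blast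
  moreover have "component (N \<union> N') (a i) \<inter> a ` I = a ` {k \<in> I. a k \<in> component (N \<union> N') (a i)}"
    by auto
  ultimately show ?thesis
    by (metis (no_types, lifting) card_image inj inj_on_subset mem_Collect_eq subsetI)
qed

lemma partner:
  assumes "j \<in> I"
  shows partner_in: "partner I (N \<union> N') j \<in> I"
    and partner_ne: "partner I (N \<union> N') j \<noteq> j"
    and partner_component: "a (partner I (N \<union> N') j) \<in> component (N \<union> N') (a j)"
    and class_eq: "{k \<in> I. a k \<in> component (N \<union> N') (a j)} = {j, partner I (N \<union> N') j}"
proof -
  let ?L = "N \<union> N'"
  let ?S = "{k \<in> I. a k \<in> component ?L (a j)}"
  have "j \<in> ?S" using assms component_self by simp
  moreover have "card ?S = 2" by (rule card_class[OF assms])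
  moreover have "\<exists>k. S = {j, k} \<and> k \<noteq> j" if S: "j \<in> S" "card S = 2" for S :: "nat set"
  proof -
    obtain x y where xy: "S = {x, y}" "x \<noteq> y" using S(2) by (meson card_2_iff)
    show ?thesis using xy S(1) by (cases "x = j") (auto simp: insert_commute)
  qed
  ultimately obtain k where k: "?S = {j, k}" "k \<noteq> j" by meson
  have mem: "x \<in> I \<and> a x \<in> component ?L (a j) \<longleftrightarrow> x = j \<or> x = k" for x
    using k(1) by (simp add: set_eq_iff)
  have "partner I ?L j = k"
    unfolding partner_def
  proof (rule the_equality)
    show "k \<in> I \<and> k \<noteq> j \<and> a k \<in> component ?L (a j)" using mem[of k] k(2) by simp
  next
    fix x assume "x \<in> I \<and> x \<noteq> j \<and> a x \<in> component ?L (a j)"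
    then show "x = k" using mem[of x] by simp
  qed
  then show "partner I ?L j \<in> I" "partner I ?L j \<noteq> j" "a (partner I ?L j) \<in> component ?L (a j)"
    "?S = {j, partner I ?L j}"
    using mem[of k] k by simp_all
qed

lemma partner_eqI:
  assumes "j \<in> I" "k \<in> I" "k \<noteq> j" "a k \<in> component (N \<union> N') (a j)"
  shows "partner I (N \<union> N') j = k"
  using class_eq[OF assms(1)] assms by auto

lemma component_partner:
  assumes "j \<in> I"
  shows "component (N \<union> N') (a (partner I (N \<union> N') j)) = component (N \<union> N') (a j)"
  using component_eq[OF partner_component[OF assms]] .

lemma partner_partner:
  assumes "j \<in> I"
  shows "partner I (N \<union> N') (partner I (N \<union> N') j) = j"
  using partner_eqI partner_in[OF assms] partner_ne[OF assms] component_partner[OF assms] component_self assms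
  by metis

lemma even_num_between_partner:
  assumes "j \<in> I" "k = partner I (N \<union> N') j"
  shows "even (num_between I (min j k) (max j k))"
proof -
  have "N \<union> N' \<subseteq> E" using N N' by (auto simp: pms_def matchings_def)
  note * = even_num_between[OF this I card_class]
  show ?thesis
    using *[of j k] *[of k j] partner_in[OF assms(1)] partner_ne[OF assms(1)] partner_component[OF assms(1)]
      component_partner[OF assms(1)] component_self[of "a j"] assms
    by (cases "j < k") (auto simp: min_def max_def)
qed

text \<open>Inside \<open>C\<close> the two vertex sets differ only at the terminals
  \<open>a j\<close> and \<open>a k\<close>. Passing from one to the other there toggles just these
  two.\<close>

lemma flip_pms:
  assumes "j \<in> I" "k = partner I (N \<union> N') j" "C = component (N \<union> N') (a j)"
  shows "flip C N N' \<in> pms W (sym_diff X {j, k})"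
proof -
  have inj: "inj_on a I" using inj_a I inj_on_subset by blast
  have aj: "a j \<in> V" using assms I a_V by auto
  have kI: "k \<in> I" using partner_in assms by auto
  have CI: "C \<inter> a ` I = {a j, a k}"
    using class_eq[OF assms(1)] assms by auto
  have d: "a ` X \<inter> a ` Y = {}" "a ` I = a ` X \<union> a ` Y"
    using XY inj_on_image_Int[OF inj, of X Y] by (auto simp flip: image_Un)
  have "a ` (X - {j, k}) = a ` X - a ` {j, k}" "a ` ({j, k} - X) = a ` {j, k} - a ` X"
    using XY assms(1) kI by (intro inj_on_image_set_diff[OF inj]; auto)+
  then have "a ` (sym_diff X {j, k}) = sym_diff (a ` X) {a j, a k}"
    by (simp add: image_Un)
  moreover have "(sym_diff W P - C) \<union> (sym_diff W Q \<inter> C) = sym_diff W (sym_diff P R)"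
    if "C \<inter> (P \<union> Q) = R" "P \<inter> Q = {}" for P Q R
    using that by blast
  ultimately have "(sym_diff W (a ` X) - C) \<union> (sym_diff W (a ` Y) \<inter> C) = sym_diff W (a ` (sym_diff X {j, k}))"
    using CI d by simp
  then show ?thesis
    using flip_matching[OF N[unfolded pms_def] N'[unfolded pms_def] aj assms(3)]
    unfolding pms_def by simp
qed

end

end

text \<open>The successor counts \<open>j\<close> itself; it is the source of the sign change in the
  cancellation below.\<close>

lemma num_between_split:
  assumes "finite I" "j \<in> I" "i < j" "j < k"
  shows "num_between I i k = Suc (num_between I i j + num_between I j k)"
proof -
  have "{x \<in> I. i < x \<and> x < k} = insert j ({x \<in> I. i < x \<and> x < j} \<union> {x \<in> I. j < x \<and> x < k})"
    using assms by auto
  moreover have "card ({x \<in> I. i < x \<and> x < j} \<union> {x \<in> I. j < x \<and> x < k})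
      = card {x \<in> I. i < x \<and> x < j} + card {x \<in> I. j < x \<and> x < k}"
    using assms by (intro card_Un_disjoint) auto
  ultimately show ?thesis
    using assms by (simp add: num_between_def)
qed

section \<open>The condensation identity\<close>

context noncrossing_terminals
begin

lemma finite_pms: "finite (pms W X)"
  using finite_E unfolding pms_def matchings_def by simp

text \<open>Expand the product of the two numbers of matchings in each summand as pairs of matchings, and
  exchange the two matchings along the path of the superposition that starts at the terminal \<open>a j\<close>.
  If it does not end at \<open>a i\<^sub>0\<close>, this cancels the pair against another one of opposite sign;
  otherwise the sign is positive and this gives a pair counted on the left.\<close>

lemma condensation:
  assumes W: "W \<subseteq> V" and I: "finite I" "I \<subseteq> T"
    and i0: "i0 \<in> I" "\<And>i. i \<in> I \<Longrightarrow> i0 \<le> i"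
  shows "int (card (pms W {}) * card (pms W I)) =
    (\<Sum>j\<in>I - {i0}. (-1) ^ num_between I i0 j * int (card (pms W {i0, j}) * card (pms W (I - {i0, j}))))"
proof -
  \<comment> \<open>The right-hand side multiplied out: an index \<open>j\<close> together with a
    pair of matchings, weighted by the sign \<open>sg\<close>.\<close>
  define Z where "Z = (SIGMA j:I - {i0}. pms W {i0, j} \<times> pms W (I - {i0, j}))"
  define mate where "mate = (\<lambda>(j, N, N'). partner I (N \<union> N') j)"
  define C where "C = (\<lambda>(j, N, N'). component (N \<union> N') (a j))"
  define sg where "sg = (\<lambda>(j, N :: 'v set set, N' :: 'v set set). (-1) ^ num_between I i0 j :: int)"
  define \<psi> where "\<psi> = (\<lambda>z. (flip (C z) (fst (snd z)) (snd (snd z)), flip (C z) (snd (snd z)) (fst (snd z))))"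
  \<comment> \<open>The partner \<open>k\<close> becomes the new index: if \<open>k\<close> differs
    from \<open>i0\<close>, toggling \<open>j\<close> and \<open>k\<close> turns
    \<open>{i0, j}\<close> into \<open>{i0, k}\<close>.\<close>
  define \<phi> where "\<phi> = (\<lambda>z. (mate z, \<psi> z))"
  define Z0 where "Z0 = {z \<in> Z. mate z = i0}"
  define Z1 where "Z1 = {z \<in> Z. mate z \<noteq> i0}"
  have finZ: "finite Z" unfolding Z_def using I finite_pms by auto
  have *: "(\<Sum>z\<in>Z. sg z) =
    (\<Sum>j\<in>I - {i0}. (-1) ^ num_between I i0 j * int (card (pms W {i0, j}) * card (pms W (I - {i0, j}))))"
  proof -
    have "(\<Sum>z\<in>Z. sg z) = (\<Sum>j\<in>I - {i0}. \<Sum>y\<in>pms W {i0, j} \<times> pms W (I - {i0, j}). sg (j, y))"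
      unfolding Z_def using I finite_pms by (subst sum.Sigma) auto
    also have "\<dots> = (\<Sum>j\<in>I - {i0}. (-1) ^ num_between I i0 j * int (card (pms W {i0, j}) * card (pms W (I - {i0, j}))))"
      by (rule sum.cong) (auto simp: sg_def split_def card_cartesian_product)
    finally show ?thesis .
  qed
  have split: "(\<Sum>z\<in>Z. sg z) = (\<Sum>z\<in>Z0. sg z) + (\<Sum>z\<in>Z1. sg z)"
    using finZ by (subst sum.union_disjoint[symmetric]) (auto simp: Z0_def Z1_def intro: sum.cong)
  \<comment> \<open>Stated for any splitting of \<open>I\<close>, as it is applied with
    \<open>X = {i0, j}\<close> to the terms on the right and with \<open>X = {}\<close> to the pairs
    counted on the left.\<close>
  have general: "mate z \<in> I \<and> mate z \<noteq> j \<and> even (num_between I (min j (mate z)) (max j (mate z)))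
      \<and> \<psi> z \<in> pms W (sym_diff X {j, mate z}) \<times> pms W (sym_diff Y {j, mate z})
      \<and> mate (mate z, \<psi> z) = j \<and> C (mate z, \<psi> z) = C z \<and> \<psi> (mate z, \<psi> z) = (N, N')"
    if z: "z = (j, N, N')" and XY: "X \<union> Y = I" "X \<inter> Y = {}"
      and N: "N \<in> pms W X" "N' \<in> pms W Y" and j: "j \<in> I" for z j N N' X Y
  proof -
    note hyp = W I XY N j
    have YX: "Y \<union> X = I" "Y \<inter> X = {}" using XY by auto
    note hyp' = W I YX N(2,1) j
    have m: "mate z = partner I (N \<union> N') j" "C z = component (N \<union> N') (a j)"
      "\<psi> z = (flip (C z) N N', flip (C z) N' N)"
      by (auto simp: mate_def C_def \<psi>_def z)
    \<comment> \<open>The exchange leaves the union of the two matchings unchanged, hence also all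
      components and partners.\<close>
    have m2: "mate (mate z, \<psi> z) = partner I (N \<union> N') (mate z)" "C (mate z, \<psi> z) = component (N \<union> N') (a (mate z))"
      by (auto simp: mate_def C_def m(3) flip_Un)
    have "C (mate z, \<psi> z) = C z"
      using m2(2) component_partner[OF hyp] by (simp only: m(1,2))
    moreover from this have "\<psi> (mate z, \<psi> z) = (N, N')"
      using fun_cong[OF \<psi>_def, of "(mate z, \<psi> z)"] by (simp add: m(3) flip_flip)
    moreover have "mate (mate z, \<psi> z) = j"
      using m2(1) partner_partner[OF hyp] by (simp only: m(1))
    moreover have "flip (C z) N N' \<in> pms W (sym_diff X {j, mate z})"
      using flip_pms[OF hyp m(1,2)] .
    moreover have "flip (C z) N' N \<in> pms W (sym_diff Y {j, mate z})"
      using flip_pms[OF hyp', of "mate z" "C z"] m by (simp add: Un_commute)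
    ultimately show ?thesis
      using partner_in[OF hyp] partner_ne[OF hyp] even_num_between_partner[OF hyp m(1)] m by auto
  qed
  have inZ: "\<exists>j N N'. z = (j, N, N') \<and> j \<in> I \<and> i0 < j \<and> N \<in> pms W {i0, j} \<and> N' \<in> pms W (I - {i0, j})
      \<and> {i0, j} \<union> (I - {i0, j}) = I" if zZ: "z \<in> Z" for z
  proof -
    obtain j N N' where z: "z = (j, N, N')" "j \<in> I" "j \<noteq> i0" "N \<in> pms W {i0, j}" "N' \<in> pms W (I - {i0, j})"
      using zZ unfolding Z_def by auto
    moreover have "i0 < j" using i0(2)[OF z(2)] z(3) by simp
    moreover have "{i0, j} \<union> (I - {i0, j}) = I" using i0(1) z(2) by auto
    ultimately show ?thesis by blast
  qed
  have inv: "\<phi> (\<phi> z) = z" "\<phi> z \<in> Z1" "- sg (\<phi> z) = sg z" if zZ1: "z \<in> Z1" for z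
  proof -
    from zZ1 have zZ: "z \<in> Z" and mz: "mate z \<noteq> i0" by (auto simp: Z1_def)
    obtain j N N' where z: "z = (j, N, N')" and j: "j \<in> I" "i0 < j"
      and N: "N \<in> pms W {i0, j}" "N' \<in> pms W (I - {i0, j})" "{i0, j} \<union> (I - {i0, j}) = I"
      using inZ[OF zZ] by blast
    define k where "k = mate z"
    note g = general[OF z N(3) _ N(1,2) j(1), folded k_def]
    have k: "k \<in> I" "k \<noteq> j" "i0 < k"
      using g mz i0(2)[of k] by (auto simp: k_def)
    have sd: "sym_diff {i0, j} {j, k} = {i0, k}" "sym_diff (I - {i0, j}) {j, k} = I - {i0, k}"
      using k j by auto
    have phi: "\<phi> z = (k, \<psi> z)" by (simp add: \<phi>_def k_def)
    show "\<phi> (\<phi> z) = z"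
      using g unfolding phi unfolding \<phi>_def z by auto
    have "\<phi> z \<in> Z"
      using g k unfolding phi sd Z_def by auto
    then show "\<phi> z \<in> Z1"
      using g j unfolding Z1_def phi by auto
    have "even (num_between I (min j k) (max j k))" using g by auto
    \<comment> \<open>An even number of terminals separates \<open>j\<close> from \<open>k\<close>.
      Together with the smaller of the two this is an odd number, so the two signs are
      opposite.\<close>
    then have "odd (num_between I i0 j + num_between I i0 k)"
      using num_between_split[OF I(1), of j i0 k] num_between_split[OF I(1), of k i0 j] j k
      by (cases "j < k") (auto simp: min_def max_def)
    then show "- sg (\<phi> z) = sg z"
      unfolding phi by (auto simp: sg_def z split_def uminus_power_if)
  qed
  \<comment> \<open>\<open>\<phi>\<close> is a sign-reversing involution on \<open>Z1\<close>, so
    the sum equals its own negative.\<close>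
  have "(\<Sum>z\<in>Z1. sg z) = (\<Sum>z\<in>Z1. - sg z)"
    by (rule sum.reindex_bij_witness[where i = \<phi> and j = \<phi>]) (use inv in auto)
  then have Z1: "(\<Sum>z\<in>Z1. sg z) = 0"
    by (simp add: sum_negf)
  \<comment> \<open>When the partner of \<open>j\<close> is \<open>i0\<close>, the exchange leaves
    the toggled sets \<open>{}\<close> and \<open>I\<close>. The inverse recovers \<open>j\<close>
    as the partner of \<open>i0\<close>.\<close>
  have "(\<Sum>z\<in>Z0. sg z) = (\<Sum>y\<in>pms W {} \<times> pms W I. 1)"
  proof (rule sum.reindex_bij_witness[where j = \<psi> and i = "\<lambda>y. \<phi> (i0, y)"])
    fix z assume "z \<in> Z0"
    then have zZ: "z \<in> Z" and mz: "mate z = i0" by (auto simp: Z0_def)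
    obtain j N N' where z: "z = (j, N, N')" and j: "j \<in> I" "i0 < j"
      and N: "N \<in> pms W {i0, j}" "N' \<in> pms W (I - {i0, j})" "{i0, j} \<union> (I - {i0, j}) = I"
      using inZ[OF zZ] by blast
    note g = general[OF z N(3) _ N(1,2) j(1), unfolded mz]
    have sd: "sym_diff {i0, j} {j, i0} = {}" "sym_diff (I - {i0, j}) {j, i0} = I"
      using j i0 by auto
    show "\<psi> z \<in> pms W {} \<times> pms W I"
      using g unfolding sd by auto
    show "\<phi> (i0, \<psi> z) = z"
      using g unfolding \<phi>_def z by auto
    show "1 = sg z"
      using g j by (auto simp: sg_def z min_def max_def)
  next
    fix y assume "y \<in> pms W {} \<times> pms W I"
    then obtain N N' where y: "y = (N, N')" "N \<in> pms W {}" "N' \<in> pms W I" by auto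
    define k where "k = mate (i0, y)"
    have "(i0, y) = (i0, N, N')" using y by simp
    note g = general[OF this _ _ y(2,3) i0(1), folded k_def, simplified]
    have sd: "sym_diff I {i0, k} = I - {i0, k}"
      using g i0 by auto
    show "\<psi> (\<phi> (i0, y)) = y"
      using g by (auto simp: \<phi>_def y k_def)
    have "\<phi> (i0, y) \<in> Z"
      using g sd by (auto simp: \<phi>_def Z_def k_def)
    then show "\<phi> (i0, y) \<in> Z0"
      using g by (auto simp: Z0_def \<phi>_def k_def)
  qed
  then show ?thesis
    using * split Z1 by (simp add: card_cartesian_product)
qed

end

section \<open>Pfaffians indexed by finite sets\<close>

text \<open>Expansion along a row deletes two indices, which may leave a set other than an initial
  segment; hence arbitrary index sets.\<close>

definition pairings_on :: "nat set \<Rightarrow> nat set set set" where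
  "pairings_on I = {P. partition_on I P \<and> (\<forall>p\<in>P. card p = 2)}"

definition pfaffian_on :: "nat set \<Rightarrow> (nat \<Rightarrow> nat \<Rightarrow> 'a::comm_ring_1) \<Rightarrow> 'a" where
  "pfaffian_on I m = (\<Sum>P\<in>pairings_on I. (-1) ^ crossings P * (\<Prod>p\<in>P. m (Min p) (Max p)))"

lemma pfaffian_eq_pfaffian_on: "pfaffian n m = pfaffian_on {1..n} m"
  by (simp add: pfaffian_def pfaffian_on_def pairings_def pairings_on_def)

lemma pairings_on_block:
  assumes "P \<in> pairings_on I" "p \<in> P"
  shows "p \<subseteq> I" "card p = 2"
  using assms unfolding pairings_on_def partition_on_def by auto

lemma pairings_on_same_block:
  assumes "P \<in> pairings_on I" "p \<in> P" "q \<in> P" "x \<in> p" "x \<in> q"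
  shows "p = q"
  using assms unfolding pairings_on_def partition_on_def disjoint_def by blast

lemma pairings_on_mate:
  assumes "P \<in> pairings_on I" "x \<in> I"
  obtains y where "y \<noteq> x" "{x, y} \<in> P"
proof -
  obtain p where p: "p \<in> P" "x \<in> p"
    using assms unfolding pairings_on_def partition_on_def by blast
  then obtain u v where uv: "p = {u, v}" "u \<noteq> v"
    using pairings_on_block[OF assms(1)] by (meson card_2_iff)
  show ?thesis
  proof (cases "x = u")
    case True
    then show ?thesis using that[of v] p uv by simp
  next
    case False
    then have "x = v" using p uv by simp
    then show ?thesis using that[of u] p uv by (simp add: insert_commute)
  qed
qed

lemma finite_pairings_on:
  assumes "finite I"
  shows "finite (pairings_on I)" "P \<in> pairings_on I \<Longrightarrow> finite P"
proof -
  have "pairings_on I \<subseteq> Pow (Pow I)"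
    unfolding pairings_on_def partition_on_def by auto
  then show "finite (pairings_on I)" "P \<in> pairings_on I \<Longrightarrow> finite P"
    using assms by (auto intro: finite_subset)
qed

lemma insert_pairing:
  assumes "i \<in> I" "j \<in> I" "i \<noteq> j" "P \<in> pairings_on (I - {i, j})"
  shows "insert {i, j} P \<in> pairings_on I" "{i, j} \<notin> P"
proof -
  have "I = {i, j} \<union> (I - {i, j})" using assms by auto
  then have "partition_on I (insert {i, j} P)"
    using assms partition_on_insert[of "I - {i, j}" P "{i, j}"]
    unfolding pairings_on_def partition_on_def disjoint_def by auto
  then show "insert {i, j} P \<in> pairings_on I"
    using assms by (auto simp: pairings_on_def)
  show "{i, j} \<notin> P" using pairings_on_block(1)[OF assms(4)] by auto
qed

lemma remove_pairing:
  assumes "P \<in> pairings_on I" "{i, j} \<in> P"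
  shows "P - {{i, j}} \<in> pairings_on (I - {i, j})"
proof -
  have "p \<inter> {i, j} = {}" if "p \<in> P - {{i, j}}" for p
    using pairings_on_same_block[OF assms(1) _ assms(2)] that by blast
  then have "\<Union> (P - {{i, j}}) = \<Union> P - {i, j}"
    by fastforce
  then show ?thesis
    using assms unfolding pairings_on_def partition_on_def disjoint_def by auto
qed

text \<open>A pairing is determined by the partner \<open>j\<close> of \<open>i\<close> and by what
  remains after the block \<open>{i, j}\<close> is removed.\<close>

lemma bij_betw_insert_pairing:
  assumes "i \<in> I"
  shows "bij_betw (\<lambda>(j, P). insert {i, j} P) (SIGMA j:I - {i}. pairings_on (I - {i, j})) (pairings_on I)"
  unfolding bij_betw_def
proof
  show "inj_on (\<lambda>(j, P). insert {i, j} P) (SIGMA j:I - {i}. pairings_on (I - {i, j}))"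
  proof (rule inj_onI)
    fix z z'
    assume "z \<in> (SIGMA j:I - {i}. pairings_on (I - {i, j}))" "z' \<in> (SIGMA j:I - {i}. pairings_on (I - {i, j}))"
      and "(case z of (j, P) \<Rightarrow> insert {i, j} P) = (case z' of (j, P) \<Rightarrow> insert {i, j} P)"
    then obtain j P j' P' where z: "z = (j, P)" "z' = (j', P')"
      and j: "j \<in> I" "j \<noteq> i" "j' \<in> I" "j' \<noteq> i" and P: "P \<in> pairings_on (I - {i, j})" "P' \<in> pairings_on (I - {i, j'})"
      and eq: "insert {i, j} P = insert {i, j'} P'"
      by auto
    have "{i, j} = {i, j'}"
      using pairings_on_same_block[OF insert_pairing(1)[OF assms j(1) _ P(1)], of "{i, j}" "{i, j'}" i] eq j by auto
    then have "j = j'" by (auto simp: doubleton_eq_iff)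
    moreover from this have "P = P'"
      using insert_pairing(2)[OF assms j(1) _ P(1)] insert_pairing(2)[OF assms j(3) _ P(2)] j eq
      by (metis insert_ident)
    ultimately show "z = z'" by (simp add: z)
  qed
  show "(\<lambda>(j, P). insert {i, j} P) ` (SIGMA j:I - {i}. pairings_on (I - {i, j})) = pairings_on I"
  proof (intro equalityI subsetI)
    fix P assume P: "P \<in> pairings_on I"
    obtain j where j: "j \<noteq> i" "{i, j} \<in> P" using pairings_on_mate[OF P assms] .
    then have "j \<in> I" using pairings_on_block(1)[OF P] by blast
    then have "(j, P - {{i, j}}) \<in> (SIGMA j:I - {i}. pairings_on (I - {i, j}))"
      using remove_pairing[OF P j(2)] j by auto
    then show "P \<in> (\<lambda>(j, P). insert {i, j} P) ` (SIGMA j:I - {i}. pairings_on (I - {i, j}))"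
      using j by (intro image_eqI[of _ _ "(j, P - {{i, j}})"]) auto
  qed (use insert_pairing assms in auto)
qed

text \<open>The elements strictly between \<open>i\<close> and \<open>j\<close> whose partner is also between them come in pairs,
  and each of the others contributes one crossing with \<open>{i, j}\<close>.\<close>

lemma crossings_insert:
  assumes I: "finite I" "i \<in> I" "\<And>k. k \<in> I \<Longrightarrow> i \<le> k" and j: "j \<in> I" "i < j"
    and P: "P \<in> pairings_on (I - {i, j})"
  shows "even (crossings (insert {i, j} P)) \<longleftrightarrow> even (crossings P + num_between I i j)"
proof -
  let ?B = "{k \<in> I. i < k \<and> k < j}"
  let ?X = "{(a, b, c, d). {a, b} \<in> P \<and> {c, d} \<in> P \<and> a < c \<and> c < b \<and> b < d}"
  define D where "D = {c \<in> ?B. \<exists>d. {c, d} \<in> P \<and> j < d}"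
  \<comment> \<open>The new crossings. Since \<open>i\<close> is the least index,
    \<open>{i, j}\<close> can only be the first pair of a quadruple. Such a crossing is determined
    by its entry \<open>c\<close>, which ranges over \<open>D\<close>.\<close>
  define Y where "Y = {(a, b, c, d). a = i \<and> b = j \<and> {c, d} \<in> P \<and> i < c \<and> c < j \<and> j < d}"
  have sub: "x \<in> I \<and> x \<noteq> i \<and> x \<noteq> j \<and> i < x" if "{x, y} \<in> P \<or> {y, x} \<in> P" for x y
  proof -
    have "x \<in> I - {i, j}" using pairings_on_block(1)[OF P] that by blast
    then show ?thesis using I(3)[of x] by simp
  qed
  have finX: "finite ?X"
    by (rule finite_subset[of _ "I \<times> I \<times> I \<times> I"]) (use sub I in auto)
  have finY: "finite Y"
    by (rule finite_subset[of _ "{i} \<times> {j} \<times> I \<times> I"]) (use sub I in \<open>auto simp: Y_def\<close>)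
  have "{(a, b, c, d). {a, b} \<in> insert {i, j} P \<and> {c, d} \<in> insert {i, j} P \<and> a < c \<and> c < b \<and> b < d}
      = ?X \<union> Y"
    using sub j unfolding Y_def by (auto simp: doubleton_eq_iff) (metis order.asym)+
  moreover have "?X \<inter> Y = {}"
    using insert_pairing(2)[OF I(2) j(1) _ P] j by (auto simp: Y_def)
  ultimately have cr: "crossings (insert {i, j} P) = crossings P + card Y"
    unfolding crossings_def using finX finY by (simp add: card_Un_disjoint)
  have "inj_on (\<lambda>(a, b, c, d). c) Y"
  proof (rule inj_onI)
    fix z z'
    assume "z \<in> Y" "z' \<in> Y" "(case z of (a, b, c, d) \<Rightarrow> c) = (case z' of (a, b, c, d) \<Rightarrow> c)"
    then obtain c d d' where z: "z = (i, j, c, d)" "z' = (i, j, c, d')" and Y: "{c, d} \<in> P" "{c, d'} \<in> P"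
      by (auto simp: Y_def)
    have "{c, d} = {c, d'}" using pairings_on_same_block[OF P Y, of c] by auto
    then show "z = z'" using z by (auto simp: doubleton_eq_iff)
  qed
  moreover have "(\<lambda>(a, b, c, d). c) ` Y = D"
    using sub by (force simp: Y_def D_def image_iff)
  ultimately have cD: "card Y = card D"
    by (metis card_image)
  define S where "S = {p \<in> P. p \<subseteq> ?B}"
  have "?B - D = \<Union> S"
  proof (intro equalityI subsetI)
    fix x assume x: "x \<in> ?B - D"
    then obtain y where y: "y \<noteq> x" "{x, y} \<in> P"
      using pairings_on_mate[OF P, of x] by auto
    then have "\<not> j < y" using x by (auto simp: D_def)
    moreover have "y \<in> I" "y \<noteq> j" "i < y" using sub[of y x] y by auto
    ultimately have "{x, y} \<in> S" using x y by (auto simp: S_def)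
    then show "x \<in> \<Union> S" by auto
  next
    fix x assume "x \<in> \<Union> S"
    then obtain p where p: "p \<in> P" "p \<subseteq> ?B" "x \<in> p" by (auto simp: S_def)
    have "x \<notin> D"
    proof
      assume "x \<in> D"
      then obtain d where d: "{x, d} \<in> P" "j < d" by (auto simp: D_def)
      then have "d \<in> p" using pairings_on_same_block[OF P p(1) d(1) p(3)] by auto
      then show False using p d by auto
    qed
    then show "x \<in> ?B - D" using p by auto
  qed
  moreover have "2 dvd card (\<Union> S)"
  proof (rule dvd_partition)
    show "finite (\<Union> S)" using I by (auto intro: finite_subset[of _ I] simp: S_def)
    show "\<forall>c\<in>S. 2 dvd card c" using pairings_on_block(2)[OF P] by (auto simp: S_def)
    show "\<forall>c1\<in>S. \<forall>c2\<in>S. c1 \<noteq> c2 \<longrightarrow> c1 \<inter> c2 = {}"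
      using pairings_on_same_block[OF P] unfolding S_def by blast
  qed
  ultimately have "even (card (?B - D))" by simp
  moreover have "card ?B = card (?B - D) + card D"
    using I by (subst card_Un_disjoint[symmetric]) (auto simp: D_def intro: arg_cong[where f = card])
  ultimately show ?thesis
    unfolding cr cD num_between_def by simp
qed

text \<open>Group the pairings by the partner of the least index; \<open>crossings_insert\<close>
  gives the sign of each group relative to the smaller Pfaffian.\<close>

lemma pfaffian_on_expand:
  fixes m :: "nat \<Rightarrow> nat \<Rightarrow> 'a::comm_ring_1"
  assumes I: "finite I" "i \<in> I" "\<And>k. k \<in> I \<Longrightarrow> i \<le> k"
  shows "pfaffian_on I m = (\<Sum>j\<in>I - {i}. (-1) ^ num_between I i j * (m i j * pfaffian_on (I - {i, j}) m))"
proof -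
  let ?t = "\<lambda>P. (-1) ^ crossings P * (\<Prod>p\<in>P. m (Min p) (Max p))"
  have "pfaffian_on I m = (\<Sum>(j, P)\<in>(SIGMA j:I - {i}. pairings_on (I - {i, j})). ?t (insert {i, j} P))"
    unfolding pfaffian_on_def
    by (subst sum.reindex_bij_betw[OF bij_betw_insert_pairing[OF I(2)], symmetric]) (simp add: split_def)
  also have "\<dots> = (\<Sum>j\<in>I - {i}. \<Sum>P\<in>pairings_on (I - {i, j}). ?t (insert {i, j} P))"
    using I finite_pairings_on by (subst sum.Sigma) auto
  also have "\<dots> = (\<Sum>j\<in>I - {i}. (-1) ^ num_between I i j * (m i j * pfaffian_on (I - {i, j}) m))"
  proof (rule sum.cong[OF refl])
    fix j assume "j \<in> I - {i}"
    then have j: "j \<in> I" "i < j" using I(3)[of j] by auto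
    have "?t (insert {i, j} P) = (-1) ^ num_between I i j * (m i j * ?t P)"
      if P: "P \<in> pairings_on (I - {i, j})" for P
    proof -
      have "(-1 :: 'a) ^ crossings (insert {i, j} P) = (-1) ^ num_between I i j * (-1) ^ crossings P"
        unfolding power_add[symmetric] using crossings_insert[OF I j P]
        by (auto simp: neg_one_even_power neg_one_odd_power minus_one_power_iff)
      moreover have "finite P" using finite_pairings_on(2) I P by blast
      then have "(\<Prod>p\<in>insert {i, j} P. m (Min p) (Max p)) = m i j * (\<Prod>p\<in>P. m (Min p) (Max p))"
        using insert_pairing(2)[OF I(2) j(1) _ P] j by (simp add: min_def max_def)
      ultimately show ?thesis by (simp add: mult_ac)
    qed
    then show "(\<Sum>P\<in>pairings_on (I - {i, j}). ?t (insert {i, j} P))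
        = (-1) ^ num_between I i j * (m i j * pfaffian_on (I - {i, j}) m)"
      unfolding pfaffian_on_def sum_distrib_left by (rule sum.cong[OF refl])
  qed
  finally show ?thesis .
qed

text \<open>Blocks have two elements, so only entries above the diagonal are evaluated.\<close>

lemma pfaffian_on_cong:
  assumes "\<And>i j. i \<in> I \<Longrightarrow> j \<in> I \<Longrightarrow> i < j \<Longrightarrow> m i j = m' i j"
  shows "pfaffian_on I m = pfaffian_on I m'"
proof -
  have "m (Min p) (Max p) = m' (Min p) (Max p)" if p: "P \<in> pairings_on I" "p \<in> P" for P p
  proof -
    obtain x y where xy: "p = {x, y}" "x \<noteq> y" "x \<in> I" "y \<in> I"
      using pairings_on_block[OF p] by (metis card_2_iff insert_subset)
    then show ?thesis
      using assms[of x y] assms[of y x] by (cases x y rule: linorder_cases) (auto simp: min_def max_def)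
  qed
  then show ?thesis
    unfolding pfaffian_on_def by (auto intro!: sum.cong prod.cong arg_cong[where f = "(*) _"])
qed

lemma pfaffian_on_empty: "pfaffian_on {} m = 1"
proof -
  have "pairings_on {} = {{}}"
    by (auto simp: pairings_on_def partition_on_def)
  then show ?thesis by (simp add: pfaffian_on_def crossings_def case_prod_unfold)
qed

section \<open>Numbers of matchings as Pfaffians\<close>

context noncrossing_terminals
begin

text \<open>With \<open>card (pms W {}) = 1\<close>, condensation is the same recursion as the
  expansion of the Pfaffian along the row of the least index.\<close>

lemma card_pms_eq_pfaffian_on:
  assumes "W \<subseteq> V" "finite I" "I \<subseteq> T" "even (card I)" "card (pms W {}) = 1"
  shows "int (card (pms W I)) = pfaffian_on I (\<lambda>i j. int (card (pms W {i, j})))"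
  using assms(2-4)
proof (induction "card I" arbitrary: I rule: less_induct)
  case less
  show ?case
  proof (cases "I = {}")
    case True
    then show ?thesis using assms(5) by (simp add: pfaffian_on_empty)
  next
    case False
    define i where "i = Min I"
    have i: "i \<in> I" "\<And>k. k \<in> I \<Longrightarrow> i \<le> k"
      using False less.prems by (auto simp: i_def)
    have IH: "int (card (pms W (I - {i, j}))) = pfaffian_on (I - {i, j}) (\<lambda>i j. int (card (pms W {i, j})))"
      if j: "j \<in> I - {i}" for j
    proof -
      have "card (I - {i, j}) = card I - 2" "card I > 0"
        using i(1) j less.prems by (auto simp: card_Diff_subset card_gt_0_iff)
      then show ?thesis
        using less.hyps[of "I - {i, j}"] less.prems by auto
    qed
    show ?thesis
      using condensation[OF assms(1) less.prems(1,2) i] assms(5) IH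
        pfaffian_on_expand[OF less.prems(1) i, of "\<lambda>i j. int (card (pms W {i, j}))"]
      by simp
  qed
qed

end

section \<open>Plane graphs\<close>

lemma plane_graphD:
  assumes "plane_graph G"
  shows "finite (verts G)" "finite (edges G)"
    and "\<And>e. e \<in> edges G \<Longrightarrow> \<exists>g. arc g \<and> path_image g = e \<and> e \<inter> verts G = {pathstart g, pathfinish g}"
    and "\<And>e f. e \<in> edges G \<Longrightarrow> f \<in> edges G \<Longrightarrow> e \<noteq> f \<Longrightarrow> e \<inter> f \<subseteq> verts G"
  using assms unfolding plane_graph_def by simp_all

lemma plane_graph_multigraph:
  assumes "plane_graph G"
  shows "multigraph (verts G) (edges G)"
proof (rule multigraph.intro)
  fix e assume "e \<in> edges G"
  then obtain g where "arc g" "e \<inter> verts G = {pathstart g, pathfinish g}"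
    using plane_graphD(3)[OF assms] by meson
  then show "card (e \<inter> verts G) = 2"
    using arc_distinct_ends[of g] by simp
qed (fact plane_graphD[OF assms])+

text \<open>The part of the plane occupied by a component; \<open>s\<close> is inserted to cover the
  case that no edge of \<open>L\<close> is incident with it.\<close>

definition component_points :: "drawn_graph \<Rightarrow> complex set set \<Rightarrow> complex \<Rightarrow> complex set" where
  "component_points G L s =
     insert s (\<Union>{e \<in> L. e \<inter> multigraph.component (verts G) L s \<noteq> {}})"

lemma path_component_component_points:
  assumes G: "plane_graph G" and L: "L \<subseteq> edges G"
    and v: "v \<in> multigraph.component (verts G) L s"
  shows "path_component (component_points G L s) s v"
proof -
  interpret multigraph "verts G" "edges G" using plane_graph_multigraph[OF G] .
  show ?thesis
    using v
  proof (induction rule: component_induct)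
    case self
    show ?case unfolding component_points_def by (rule path_component_refl) simp
  next
    case (step x y e)
    have "e \<in> edges G" using \<open>e \<in> L\<close> L by blast
    then obtain g where g: "arc g" "path_image g = e"
      using plane_graphD(3)[OF G] by meson
    have "path_connected e"
      using path_connected_path_image[OF arc_imp_path[OF g(1)]] g(2) by simp
    then have "path_component e x y"
      using \<open>x \<in> e \<inter> verts G\<close> \<open>y \<in> e \<inter> verts G\<close> unfolding path_connected_component by simp
    moreover have "e \<inter> component L s \<noteq> {}" using \<open>x \<in> e \<inter> verts G\<close> \<open>x \<in> component L s\<close> by blast
    then have "e \<subseteq> component_points G L s"
      using \<open>e \<in> L\<close> unfolding component_points_def by blast
    ultimately show ?case
      using step.IH path_component_trans path_component_of_subset by metis
  qed
qed

text \<open>A common point would be a vertex of both components, or an interior point of an edge.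
  Distinct edges meet only in vertices, so in the second case that edge would touch both
  components.\<close>

lemma component_points_disjoint:
  assumes G: "plane_graph G" and L: "L \<subseteq> edges G" and V: "s \<in> verts G" "s' \<in> verts G"
    and s': "s' \<notin> multigraph.component (verts G) L s"
  shows "component_points G L s \<inter> component_points G L s' = {}"
proof (rule ccontr)
  interpret multigraph "verts G" "edges G" using plane_graph_multigraph[OF G] .
  have V_in: "x \<in> component L r" if "x \<in> component_points G L r" "x \<in> verts G" "r \<in> verts G" for x r
    using that component_self[of r L] component_edge[of _ L _ r] component_subset[of r L]
    unfolding component_points_def by blast
  have disj: "component L s \<inter> component L s' = {}"
    using component_eq s' component_self by blast
  assume "component_points G L s \<inter> component_points G L s' \<noteq> {}"
  then obtain z where z: "z \<in> component_points G L s" "z \<in> component_points G L s'" by auto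
  show False
  proof (cases "z \<in> verts G")
    case True
    then show False using V_in[OF z(1)] V_in[OF z(2)] V disj by auto
  next
    case False
    then obtain e f where e: "e \<in> L" "z \<in> e" "e \<inter> component L s \<noteq> {}"
      and f: "f \<in> L" "z \<in> f" "f \<inter> component L s' \<noteq> {}"
      using z V by (auto simp: component_points_def)
    have "e \<inter> f \<subseteq> verts G" if "e \<noteq> f"
      using plane_graphD(4)[OF G] L e(1) f(1) that by (meson subsetD)
    then have "e = f" using False e(2) f(2) by blast
    moreover obtain x where "x \<in> e" "x \<in> component L s" using e by auto
    moreover from this have "e \<inter> verts G \<subseteq> component L s"
      using component_edge[of e L x s] component_subset[OF V(1)] e by auto
    moreover obtain y where "y \<in> f" "y \<in> component L s'" using f by auto
    ultimately show False
      using component_subset[OF V(2)] disj by blast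
  qed
qed

text \<open>Two different components joining interlaced terminals would contain disjoint
  connections. Both lie in the drawing, so they meet the closed disc in the face only at terminals,
  which contradicts \<open>interlaced_outside_loop_meet\<close>.\<close>

lemma cyclic_order_noncrossing_terminals:
  assumes G: "plane_graph G" and inj: "inj_on a {1..n}" and aV: "a ` {1..n} \<subseteq> verts G"
    and F: "F \<in> faces G" and cyc: "cyclic_order_on_face F n a"
  shows "noncrossing_terminals (verts G) (edges G) a {1..n}"
proof -
  interpret multigraph "verts G" "edges G" using plane_graph_multigraph[OF G] .
  show ?thesis
  proof
    fix L i j k l
    assume L: "L \<subseteq> edges G" and ijkl: "{i, j, k, l} \<subseteq> {1..n}" "i < j" "j < k" "k < l"
      and k: "a k \<in> component L (a i)" and l: "a l \<in> component L (a j)"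
    show "a j \<in> component L (a i)"
    proof (rule ccontr)
      assume "a j \<notin> component L (a i)"
      then have disj: "component_points G L (a i) \<inter> component_points G L (a j) = {}"
        using component_points_disjoint[OF G L, of "a i" "a j"] ijkl(1) aV
        by (meson image_subset_iff insert_subset)
      obtain c t where c: "simple_path c" "pathfinish c = pathstart c"
        and cF: "path_image c \<union> inside (path_image c) - a ` {1..n} \<subseteq> F"
        and t: "t ` {1..n} \<subseteq> {0..<1}" "strict_mono_on {1..n} t" "\<And>i. i \<in> {1..n} \<Longrightarrow> c (t i) = a i"
        using cyc unfolding cyclic_order_on_face_def by blast
      obtain p0 where p0: "path p0" "path_image p0 \<subseteq> component_points G L (a i)" "pathstart p0 = a i" "pathfinish p0 = a k"
        using path_component_component_points[OF G L k] unfolding path_component_def by blast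
      have "a i \<noteq> a k"
        using inj ijkl by (auto dest: inj_onD)
      then obtain p where p: "arc p" "path_image p \<subseteq> path_image p0" "pathstart p = a i" "pathfinish p = a k"
        using path_contains_arc[OF p0(1,3,4)] by metis
      obtain q where q: "path q" "path_image q \<subseteq> component_points G L (a j)" "pathstart q = a j" "pathfinish q = a l"
        using path_component_component_points[OF G L l] unfolding path_component_def by blast
      define \<Gamma> where "\<Gamma> = verts G \<union> \<Union>(edges G)"
      have "F \<subseteq> - \<Gamma>"
        using F unfolding faces_def \<Gamma>_def by (rule in_components_subset)
      moreover have "component_points G L (a r) \<subseteq> \<Gamma>" if "r \<in> {1..n}" for r
        using L aV imageI[OF that, of a] unfolding component_points_def \<Gamma>_def by blast
      then have "path_image p \<union> path_image q \<subseteq> \<Gamma>"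
        using p(2) p0(2) q(2) ijkl(1) by (meson Un_least insert_subset order_trans)
      ultimately have meet: "(path_image c \<union> inside (path_image c)) \<inter> (path_image p \<union> path_image q) \<subseteq> a ` {1..n}"
        using cF by (smt (verit) Compl_iff DiffI IntE subset_iff)
      have "a r \<in> path_image c" if "r \<in> {1..n}" for r
      proof -
        have "t r \<in> {0..1}" using t(1) that by force
        then show ?thesis
          unfolding path_image_def t(3)[OF that, symmetric] by (rule imageI)
      qed
      then have "a ` {1..n} \<subseteq> path_image c" by auto
      \<comment> \<open>All terminals lie on the curve itself, so none of the possible meeting
        points is inside.\<close>
      then have "inside (path_image c) \<inter> (path_image p \<union> path_image q) = {}"
        using meet inside_no_overlap[of "path_image c"] by blast
      moreover have "finite (path_image c \<inter> (path_image p \<union> path_image q))"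
        by (rule finite_subset[of _ "a ` {1..n}"]) (use meet in auto)
      moreover have "t i \<in> {0..<1}" "t l \<in> {0..<1}"
        by (intro subsetD[OF t(1)] imageI; use ijkl in simp)+
      then have "0 \<le> t i" "t i < t j" "t j < t k" "t k < t l" "t l < 1"
        using ijkl strict_mono_onD[OF t(2)] by auto
      moreover have "a j \<in> path_image q" "a l \<in> path_image q"
        using q by (metis pathstart_in_path_image pathfinish_in_path_image)+
      ultimately have "path_image p \<inter> path_image q \<noteq> {}"
        using interlaced_outside_loop_meet[OF c p(1), of "t i" "t k" "path_image q" "t j" "t l"]
          p q t(3) ijkl connected_path_image by auto
      then show False using p(2) p0(2) q(2) disj by blast
    qed
  qed (use inj aV in auto)
qed

section \<open>From induced subgraphs to prescribed degrees\<close>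

lemma card_Collect_eq_1_iff: "card {x. P x} = 1 \<longleftrightarrow> (\<exists>!x. P x)"
  unfolding One_nat_def card_1_singleton_iff set_eq_iff mem_Collect_eq singleton_iff Ex1_def by blast

text \<open>The edges of the induced subgraph are those without an end outside \<open>W\<close>.
  Using only these means having degree 0 at all vertices outside \<open>W\<close>.\<close>

lemma num_pm_induced:
  assumes "finite (edges G)"
  shows "num_pm (induced G W) = card (matchings (verts G) (edges G) (verts G \<inter> W))"
proof -
  have "perfect_matching (induced G W) M \<longleftrightarrow> M \<in> matchings (verts G) (edges G) (verts G \<inter> W)" for M
  proof (cases "M \<subseteq> edges G")
    case True
    \<comment> \<open>Finiteness makes cardinality 0 equivalent to the absence of edges, as
      \<open>card\<close> is also 0 on infinite sets.\<close>
    then have fin: "finite {e \<in> M. v \<in> e}" for v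
      by (intro finite_subset[OF _ assms]) blast
    have one: "card {e \<in> M. v \<in> e} = 1 \<longleftrightarrow> (\<exists>!e. e \<in> M \<and> v \<in> e)" for v
      by (rule card_Collect_eq_1_iff)
    have zero: "card {e \<in> M. v \<in> e} = 0 \<longleftrightarrow> (\<forall>e\<in>M. v \<notin> e)" for v
      using fin[of v] by auto
    have "perfect_matching (induced G W) M \<longleftrightarrow>
        (\<forall>e\<in>M. e \<inter> verts G \<subseteq> W) \<and> (\<forall>v\<in>verts G \<inter> W. card {e \<in> M. v \<in> e} = 1)"
    proof -
      have "M \<subseteq> edges (induced G W) \<longleftrightarrow> (\<forall>e\<in>M. e \<inter> verts G \<subseteq> W)"
        using True unfolding induced_def select_convs by blast
      moreover have "verts (induced G W) = verts G \<inter> W" by (simp add: induced_def)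
      ultimately show ?thesis unfolding perfect_matching_def one by simp
    qed
    also have "\<dots> \<longleftrightarrow> (\<forall>v\<in>verts G. (v \<notin> W \<longrightarrow> card {e \<in> M. v \<in> e} = 0) \<and> (v \<in> W \<longrightarrow> card {e \<in> M. v \<in> e} = 1))"
      unfolding zero by blast
    also have "\<dots> \<longleftrightarrow> (\<forall>v\<in>verts G. card {e \<in> M. v \<in> e} = of_bool (v \<in> verts G \<inter> W))"
      by (intro ball_cong refl) simp
    finally show ?thesis
      using True by (simp add: matchings_def)
  next
    case False
    then have "\<not> M \<subseteq> edges (induced G W)" by (auto simp: induced_def)
    then show ?thesis
      using False by (simp add: perfect_matching_def matchings_def)
  qed
  then show ?thesis by (simp add: num_pm_def)
qed

theorem theorem3p1:
  fixes G H K :: drawn_graph and F A AK AH :: "complex set"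
    and n :: nat and a :: "nat \<Rightarrow> complex"
  assumes "plane_graph G"
    and "even n"
    and "inj_on a {1..n}"
    and "A = a ` {1..n}"
    and "A \<subseteq> verts G"
    and "F \<in> faces G"
    and "cyclic_order_on_face F n a"
    and "A = AK \<union> AH"
    and "AK \<inter> AH = {}"
    and "H = remove_verts G AK"
    and "K = remove_verts G AH"
    and "num_pm H = 1"
  shows "int (num_pm K) = pfaffian n (\<lambda>i j. int (num_pm (H_sub G AK AH (a i) (a j))))"
proof -
  \<comment> \<open>The vertex set of \<open>H\<close>, from which all the other subgraphs arise by
    toggling terminals.\<close>
  define W where "W = verts G - AK"
  interpret noncrossing_terminals "verts G" "edges G" a "{1..n}"
    using cyclic_order_noncrossing_terminals[OF assms(1,3) _ assms(6,7)] assms(4,5) by blast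
  have num_pm: "num_pm (induced G U) = card (pms W X)" if "verts G \<inter> U = sym_diff W (a ` X)" for U X
    using num_pm_induced[OF finite_E, of U] that by (simp add: pms_def)
  have "num_pm H = card (pms W {})"
    unfolding assms(10) remove_verts_def by (rule num_pm) (auto simp: W_def)
  then have "card (pms W {}) = 1" using assms(12) by (rule trans[OF sym])
  moreover have "W \<subseteq> verts G" by (auto simp: W_def)
  ultimately have pf: "int (card (pms W {1..n})) = pfaffian_on {1..n} (\<lambda>i j. int (card (pms W {i, j})))"
    using card_pms_eq_pfaffian_on[of W "{1..n}"] assms(2) by simp
  have K: "num_pm K = card (pms W {1..n})"
    unfolding assms(11) remove_verts_def
  proof (rule num_pm)
    \<comment> \<open>Toggling every terminal restores \<open>AK\<close> and deletes
      \<open>AH\<close>.\<close>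
    show "verts G \<inter> (verts G - AH) = sym_diff W (a ` {1..n})"
      using assms(5,8,9) unfolding W_def assms(4)[symmetric] by blast
  qed
  have "num_pm (H_sub G AK AH (a i) (a j)) = card (pms W {i, j})"
    if ij: "i \<in> {1..n}" "j \<in> {1..n}" "i < j" for i j
  proof -
    have ne: "a i \<noteq> a j" using inj_onD[OF assms(3) _ ij(1,2)] ij(3) by auto
    have "a i \<in> A" "a j \<in> A" using ij assms(4) by blast+
    then have a: "a i \<in> AH \<longleftrightarrow> a i \<notin> AK" "a j \<in> AH \<longleftrightarrow> a j \<notin> AK" "a i \<in> verts G" "a j \<in> verts G"
      using assms(5,8,9) by blast+
    \<comment> \<open>All four cases toggle \<open>a i\<close> and \<open>a j\<close>: a terminal in
      \<open>AK\<close> is absent from \<open>W\<close> and gets added, one in \<open>AH\<close> is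
      present and gets deleted.\<close>
    define U where "U = (if a i \<in> AK \<and> a j \<in> AK then W \<union> {a i, a j}
      else if a i \<in> AK \<and> a j \<in> AH then (W - {a j}) \<union> {a i}
      else if a i \<in> AH \<and> a j \<in> AK then (W - {a i}) \<union> {a j} else W - {a i, a j})"
    have "verts (remove_verts G AK) = W"
      by (auto simp: remove_verts_def induced_def W_def)
    moreover have "remove_verts (remove_verts G AK) S = induced G (W - S)" for S
      by (auto simp: remove_verts_def induced_def W_def)
    ultimately have "H_sub G AK AH (a i) (a j) = induced G U"
      by (simp add: H_sub_def Let_def U_def)
    moreover have "verts G \<inter> U = sym_diff W {a i, a j}"
      unfolding U_def W_def using a ne by (cases "a i \<in> AK"; cases "a j \<in> AK") auto
    ultimately show ?thesis using num_pm[of U "{i, j}"] by simp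
  qed
  then have "pfaffian n (\<lambda>i j. int (num_pm (H_sub G AK AH (a i) (a j)))) =
      pfaffian_on {1..n} (\<lambda>i j. int (card (pms W {i, j})))"
    unfolding pfaffian_eq_pfaffian_on by (intro pfaffian_on_cong) auto
  then show ?thesis
    unfolding K pf by simp
qed

end
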